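(* Assume CH. If $X$ is $\beta\omega\setminus\omega$ or $\beta\omega$, then there are $2^{\mathfrak{c}}$ cofinal types of neighborhood filters in $X$, but all the cofinally scalene neighborhood filters in $X$ are cofinally equivalent to $\mathfrak{c}$ if $X=\beta\omega\setminus\omega$, and all of them are cofinally equivalent to $1$ if $X=\beta\omega$.
   Context: $\mathfrak{c}=2^{\aleph_0}$. $\beta\omega$ is the Stone–Čech compactification of the discrete space $\omega$ and $\beta\omega\setminus\omega$ is its remainder. A neighborhood filter in $X$ is a set $\mathrm{Nbhd}(p,X)$ with $p\in X$, consisting of all $U\subseteq X$ such that $p$ is in the interior of $U$, preordered by containment $\supseteq$ (smaller neighborhoods are greater). Preorders $P$ and $Q$ are cofinally equivalent if there is a preorder $R$ such that $P$ and $Q$ are order isomorphic to cofinal subsets of $R$; a cofinal type is an equivalence class of this relation. $\mathrm{Reg}$ is the class of regular cardinals, where by convention $1$ is the unique finite regular cardinal. A preorder is cofinally scalene if it is cofinally equivalent to $\prod S$ for some set $S\subseteq\mathrm{Reg}$, where $\prod S$ is the set of functions $f$ on $S$ with $f(\mu)\in\mu$ for all $\mu\in S$, ordered coordinatewise (and $\prod\varnothing=\{\varnothing\}$). *)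

theory Defs
  imports "HOL-Analysis.Analysis"
begin

unbundle cardinal_syntax

section \<open>Cofinal types of preorders\<close>

text \<open>
  A preorder is a relation \<open>P\<close> with \<^term>\<open>Preorder P\<close>; its underlying set is \<^term>\<open>Field P\<close>.
  Order isomorphism is the library's \<^const>\<open>iso\<close>, which for arbitrary relations is
  an order-preserving and order-reflecting bijection between the fields (\<open>iso_iff2\<close>).
  The library's \<open>cofinal\<close> is about strict bounds and is not suitable for general preorders.
\<close>

definition cofinal_subset :: "'a set \<Rightarrow> 'a rel \<Rightarrow> bool" where
  "cofinal_subset A R \<longleftrightarrow> A \<subseteq> Field R \<and> (\<forall>x\<in>Field R. \<exists>y\<in>A. (x, y) \<in> R)"

text \<open>
  The witness \<open>R\<close> may be required to live on the sum type: the lemma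
  \<open>cofinally_equivalentI\<close> below shows that a witness on any other type is as good.
\<close>

definition cofinally_equivalent :: "'a rel \<Rightarrow> 'b rel \<Rightarrow> bool" where
  "cofinally_equivalent P Q \<longleftrightarrow>
     (\<exists>R :: ('a + 'b) rel. Preorder R \<and>
        (\<exists>A f. cofinal_subset A R \<and> iso P (Restr R A) f) \<and>
        (\<exists>B g. cofinal_subset B R \<and> iso Q (Restr R B) g))"

text \<open>
  The equivalence class of \<open>P\<close>, restricted to the preorders on subsets of one type (all
  preorders form a proper class). Among preorders on that type, classes are
  equal iff the preorders are cofinally equivalent (lemma \<open>cofinal_type_eq_iff\<close>).
\<close>

definition cofinal_type :: "'a rel \<Rightarrow> 'a rel set" where
  "cofinal_type P = {Q. cofinally_equivalent P Q}"

lemma Field_Restr_Preorder: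
  assumes "Preorder R" "A \<subseteq> Field R"
  shows "Field (Restr R A) = A"
proof
  show "Field (Restr R A) \<subseteq> A"
    by (auto simp: Field_def)
  show "A \<subseteq> Field (Restr R A)"
  proof
    fix x assume "x \<in> A"
    then have "(x, x) \<in> Restr R A"
      using assms by (auto simp: preorder_on_def refl_on_def)
    then show "x \<in> Field (Restr R A)"
      by (rule FieldI1)
  qed
qed

lemma cofinally_equivalentI_rel:
  fixes L :: "'a \<Rightarrow> 'b \<Rightarrow> bool" and M :: "'b \<Rightarrow> 'a \<Rightarrow> bool"
  assumes P: "Preorder P" and Q: "Preorder Q"
    and L: "\<And>p q. L p q \<Longrightarrow> p \<in> Field P \<and> q \<in> Field Q"
    and M: "\<And>q p. M q p \<Longrightarrow> q \<in> Field Q \<and> p \<in> Field P"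
    and PL: "\<And>p p' q. (p, p') \<in> P \<Longrightarrow> L p' q \<Longrightarrow> L p q"
    and LQ: "\<And>p q q'. L p q \<Longrightarrow> (q, q') \<in> Q \<Longrightarrow> L p q'"
    and QM: "\<And>q q' p. (q, q') \<in> Q \<Longrightarrow> M q' p \<Longrightarrow> M q p"
    and MP: "\<And>q p p'. M q p \<Longrightarrow> (p, p') \<in> P \<Longrightarrow> M q p'"
    and LMp: "\<And>p q p'. L p q \<Longrightarrow> M q p' \<Longrightarrow> (p, p') \<in> P"
    and MLq: "\<And>q p q'. M q p \<Longrightarrow> L p q' \<Longrightarrow> (q, q') \<in> Q"
    and exL: "\<And>p. p \<in> Field P \<Longrightarrow> \<exists>q. L p q"
    and exM: "\<And>q. q \<in> Field Q \<Longrightarrow> \<exists>p. M q p"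
  shows "cofinally_equivalent P Q"
proof -
  define R :: "('a + 'b) rel" where
    "R = {(x, y). case x of
            Inl p \<Rightarrow> (case y of Inl p' \<Rightarrow> (p, p') \<in> P | Inr q \<Rightarrow> L p q)
          | Inr q \<Rightarrow> (case y of Inl p \<Rightarrow> M q p | Inr q' \<Rightarrow> (q, q') \<in> Q)}"
  have [simp]: "(Inl p, Inl p') \<in> R \<longleftrightarrow> (p, p') \<in> P" "(Inl p, Inr q) \<in> R \<longleftrightarrow> L p q"
    "(Inr q, Inl p) \<in> R \<longleftrightarrow> M q p" "(Inr q, Inr q') \<in> R \<longleftrightarrow> (q, q') \<in> Q" for p p' q q'
    by (auto simp: R_def)
  have reflP: "(p, p) \<in> P" if "p \<in> Field P" for p
    using P that by (auto simp: preorder_on_def refl_on_def)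
  have reflQ: "(q, q) \<in> Q" if "q \<in> Field Q" for q
    using Q that by (auto simp: preorder_on_def refl_on_def)
  have trP: "trans P" and trQ: "trans Q"
    using P Q by (auto simp: preorder_on_def)
  have FR: "Field R = Inl ` Field P \<union> Inr ` Field Q"
  proof
    show "Inl ` Field P \<union> Inr ` Field Q \<subseteq> Field R"
    proof -
      have "Inl p \<in> Field R" if "p \<in> Field P" for p
        using reflP[OF that] by (intro FieldI1[of "Inl p" "Inl p"]) simp
      moreover have "Inr q \<in> Field R" if "q \<in> Field Q" for q
        using reflQ[OF that] by (intro FieldI1[of "Inr q" "Inr q"]) simp
      ultimately show ?thesis by blast
    qed
    have "x \<in> Inl ` Field P \<union> Inr ` Field Q \<and> y \<in> Inl ` Field P \<union> Inr ` Field Q"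
      if "(x, y) \<in> R" for x y
      using that by (cases x; cases y) (auto dest: L M simp: FieldI1 FieldI2)
    then show "Field R \<subseteq> Inl ` Field P \<union> Inr ` Field Q"
      unfolding Field_def by blast
  qed
  have preR: "Preorder R"
    unfolding preorder_on_def
  proof (intro conjI)
    show "R \<subseteq> Field R \<times> Field R"
      by (auto intro: FieldI1 FieldI2)
    show "refl_on (Field R) R"
      unfolding refl_on_def FR using reflP reflQ by auto
    have "(x, z) \<in> R" if "(x, y) \<in> R" "(y, z) \<in> R" for x y z
      using that
      by (cases x; cases y; cases z; simp)
        (erule (1) transD[OF trP] transD[OF trQ] PL LQ QM MP LMp MLq)+
    then show "trans R"
      by (rule transI)
  qed
  have cA: "cofinal_subset (Inl ` Field P) R"
    unfolding cofinal_subset_def FR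
  proof (intro conjI ballI)
    fix x assume "x \<in> Inl ` Field P \<union> Inr ` Field Q"
    then show "\<exists>y\<in>Inl ` Field P. (x, y) \<in> R"
      by (elim UnE imageE) (use reflP exM M in fastforce)+
  qed auto
  have cB: "cofinal_subset (Inr ` Field Q) R"
    unfolding cofinal_subset_def FR
  proof (intro conjI ballI)
    fix x assume "x \<in> Inl ` Field P \<union> Inr ` Field Q"
    then show "\<exists>y\<in>Inr ` Field Q. (x, y) \<in> R"
      by (elim UnE imageE) (use reflQ exL L in fastforce)+
  qed auto
  have "iso P (Restr R (Inl ` Field P)) Inl"
    unfolding iso_iff2 using Field_Restr_Preorder[OF preR, of "Inl ` Field P"] FR
    by (auto simp: bij_betw_def)
  moreover have "iso Q (Restr R (Inr ` Field Q)) Inr"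
    unfolding iso_iff2 using Field_Restr_Preorder[OF preR, of "Inr ` Field Q"] FR
    by (auto simp: bij_betw_def)
  ultimately show ?thesis
    unfolding cofinally_equivalent_def using preR cA cB by blast
qed

lemma Preorder_iso_Restr:
  assumes R: "Preorder R" "A \<subseteq> Field R" and f: "iso P (Restr R A) f"
  shows "Preorder P"
proof -
  have F: "Field (Restr R A) = A"
    using R by (rule Field_Restr_Preorder)
  have f1: "\<And>p. p \<in> Field P \<Longrightarrow> f p \<in> A"
    and f2: "\<And>p p'. p \<in> Field P \<Longrightarrow> p' \<in> Field P \<Longrightarrow> (p, p') \<in> P \<longleftrightarrow> (f p, f p') \<in> R"
    using f unfolding iso_iff2 F by (auto simp: bij_betw_def)
  show ?thesis
    unfolding preorder_on_def
  proof (intro conjI)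
    show "P \<subseteq> Field P \<times> Field P"
      by (auto intro: FieldI1 FieldI2)
    show "refl_on (Field P) P"
      using R f1 f2 subsetD[OF assms(2)] by (auto simp: refl_on_def preorder_on_def)
    show "trans P"
    proof (rule transI)
      fix x y z assume xy: "(x, y) \<in> P" and yz: "(y, z) \<in> P"
      then have "x \<in> Field P" "y \<in> Field P" "z \<in> Field P"
        by (auto intro: FieldI1 FieldI2)
      then show "(x, z) \<in> P"
        using xy yz R f2 by (meson preorder_on_def transD)
    qed
  qed
qed

lemma cofinally_equivalentI:
  fixes R :: "'c rel"
  assumes R: "Preorder R"
    and A: "cofinal_subset A R" "iso P (Restr R A) f"
    and B: "cofinal_subset B R" "iso Q (Restr R B) g"
  shows "cofinally_equivalent P Q"
proof -
  have sub: "A \<subseteq> Field R" "B \<subseteq> Field R"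
    using A B by (auto simp: cofinal_subset_def)
  have FA: "Field (Restr R A) = A"
    using R sub(1) by (rule Field_Restr_Preorder)
  have FB: "Field (Restr R B) = B"
    using R sub(2) by (rule Field_Restr_Preorder)
  have f1: "f ` Field P = A"
    and f2: "\<And>p p'. p \<in> Field P \<Longrightarrow> p' \<in> Field P \<Longrightarrow> (p, p') \<in> P \<longleftrightarrow> (f p, f p') \<in> R"
    using A(2) unfolding iso_iff2 FA by (auto simp: bij_betw_def)
  have g1: "g ` Field Q = B"
    and g2: "\<And>q q'. q \<in> Field Q \<Longrightarrow> q' \<in> Field Q \<Longrightarrow> (q, q') \<in> Q \<longleftrightarrow> (g q, g q') \<in> R"
    using B(2) unfolding iso_iff2 FB by (auto simp: bij_betw_def)
  have tr: "\<And>x y z. (x, y) \<in> R \<Longrightarrow> (y, z) \<in> R \<Longrightarrow> (x, z) \<in> R"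
    using R by (meson preorder_on_def transD)
  have fI: "\<And>p p'. (p, p') \<in> P \<Longrightarrow> p \<in> Field P \<and> p' \<in> Field P \<and> (f p, f p') \<in> R"
    by (metis FieldI1 FieldI2 f2)
  have gI: "\<And>q q'. (q, q') \<in> Q \<Longrightarrow> q \<in> Field Q \<and> q' \<in> Field Q \<and> (g q, g q') \<in> R"
    by (metis FieldI1 FieldI2 g2)
  define L where "L = (\<lambda>p q. p \<in> Field P \<and> q \<in> Field Q \<and> (f p, g q) \<in> R)"
  define M where "M = (\<lambda>q p. p \<in> Field P \<and> q \<in> Field Q \<and> (g q, f p) \<in> R)"
  show ?thesis
  proof (rule cofinally_equivalentI_rel[of P Q L M])
    show "Preorder P"
      using R sub(1) A(2) by (rule Preorder_iso_Restr)
    show "Preorder Q"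
      using R sub(2) B(2) by (rule Preorder_iso_Restr)
    show "\<exists>q. L p q" if "p \<in> Field P" for p
    proof -
      have "f p \<in> Field R"
        using that f1 sub(1) by auto
      then obtain y where "y \<in> B" "(f p, y) \<in> R"
        using B(1) unfolding cofinal_subset_def by blast
      then show ?thesis
        using that g1 by (auto simp: L_def)
    qed
    show "\<exists>p. M q p" if "q \<in> Field Q" for q
    proof -
      have "g q \<in> Field R"
        using that g1 sub(2) by auto
      then obtain y where "y \<in> A" "(g q, y) \<in> R"
        using A(1) unfolding cofinal_subset_def by blast
      then show ?thesis
        using that f1 by (auto simp: M_def)
    qed
    show "L p q" if "(p, p') \<in> P" "L p' q" for p p' q
      using fI[OF that(1)] that(2) tr[of "f p" "f p'" "g q"] by (simp add: L_def)
    show "L p q'" if "L p q" "(q, q') \<in> Q" for p q q'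
      using that(1) gI[OF that(2)] tr[of "f p" "g q" "g q'"] by (simp add: L_def)
    show "M q p" if "(q, q') \<in> Q" "M q' p" for q q' p
      using gI[OF that(1)] that(2) tr[of "g q" "g q'" "f p"] by (simp add: M_def)
    show "M q p'" if "M q p" "(p, p') \<in> P" for q p p'
      using that(1) fI[OF that(2)] tr[of "g q" "f p" "f p'"] by (simp add: M_def)
    show "(p, p') \<in> P" if "L p q" "M q p'" for p q p'
      using that f2[of p p'] tr[of "f p" "g q" "f p'"] by (simp add: L_def M_def)
    show "(q, q') \<in> Q" if "M q p" "L p q'" for q p q'
      using that g2[of q q'] tr[of "g q" "f p" "g q'"] by (simp add: L_def M_def)
  qed (simp_all add: L_def M_def)
qed

lemma cofinally_equivalentE:
  fixes P :: "'a rel" and Q :: "'b rel"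
  assumes "cofinally_equivalent P Q"
  obtains R :: "('a + 'b) rel" and f g where
    "Preorder P" "Preorder Q" "Preorder R"
    "\<And>p. p \<in> Field P \<Longrightarrow> f p \<in> Field R" "\<And>q. q \<in> Field Q \<Longrightarrow> g q \<in> Field R"
    "\<And>p p'. p \<in> Field P \<Longrightarrow> p' \<in> Field P \<Longrightarrow> (f p, f p') \<in> R \<longleftrightarrow> (p, p') \<in> P"
    "\<And>q q'. q \<in> Field Q \<Longrightarrow> q' \<in> Field Q \<Longrightarrow> (g q, g q') \<in> R \<longleftrightarrow> (q, q') \<in> Q"
    "\<And>x. x \<in> Field R \<Longrightarrow> \<exists>p\<in>Field P. (x, f p) \<in> R"
    "\<And>x. x \<in> Field R \<Longrightarrow> \<exists>q\<in>Field Q. (x, g q) \<in> R"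
proof -
  obtain R :: "('a + 'b) rel" and A f B g where R: "Preorder R"
    and A: "cofinal_subset A R" "iso P (Restr R A) f"
    and B: "cofinal_subset B R" "iso Q (Restr R B) g"
    using assms unfolding cofinally_equivalent_def by blast
  have sub: "A \<subseteq> Field R" "B \<subseteq> Field R"
    using A B by (auto simp: cofinal_subset_def)
  have FA: "Field (Restr R A) = A"
    using R sub(1) by (rule Field_Restr_Preorder)
  have FB: "Field (Restr R B) = B"
    using R sub(2) by (rule Field_Restr_Preorder)
  have f1: "f ` Field P = A"
    and f2: "\<And>p p'. p \<in> Field P \<Longrightarrow> p' \<in> Field P \<Longrightarrow> (p, p') \<in> P \<longleftrightarrow> (f p, f p') \<in> R"
    using A(2) unfolding iso_iff2 FA by (auto simp: bij_betw_def)
  have g1: "g ` Field Q = B"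
    and g2: "\<And>q q'. q \<in> Field Q \<Longrightarrow> q' \<in> Field Q \<Longrightarrow> (q, q') \<in> Q \<longleftrightarrow> (g q, g q') \<in> R"
    using B(2) unfolding iso_iff2 FB by (auto simp: bij_betw_def)
  note Preorder_iso_Restr[OF R sub(1) A(2)] Preorder_iso_Restr[OF R sub(2) B(2)]
  moreover have "\<exists>p\<in>Field P. (x, f p) \<in> R" "\<exists>q\<in>Field Q. (x, g q) \<in> R" if "x \<in> Field R" for x
    using that A(1) B(1) f1 g1 unfolding cofinal_subset_def by blast+
  ultimately show thesis
    using R f1 f2 g1 g2 sub by (intro that[of R f g]) auto
qed

lemma cofinally_equivalent_refl:
  assumes "Preorder P"
  shows "cofinally_equivalent P P"
proof (rule cofinally_equivalentI)
  show c: "cofinal_subset (Field P) P" "cofinal_subset (Field P) P"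
    using assms unfolding cofinal_subset_def preorder_on_def refl_on_def by blast+
  show "iso P (Restr P (Field P)) id" "iso P (Restr P (Field P)) id"
    by (simp_all add: iso_iff2 Restr_Field)
qed fact

lemma cofinally_equivalent_sym:
  "cofinally_equivalent P Q \<Longrightarrow> cofinally_equivalent Q P"
  unfolding cofinally_equivalent_def[of P Q] by (metis cofinally_equivalentI)

lemma cofinally_equivalent_trans:
  fixes P :: "'a rel" and Q :: "'b rel" and T :: "'c rel"
  assumes "cofinally_equivalent P Q" "cofinally_equivalent Q T"
  shows "cofinally_equivalent P T"
proof -
  obtain R :: "('a + 'b) rel" and f g where P: "Preorder P" and Q: "Preorder Q" and R: "Preorder R"
    and fF: "\<And>p. p \<in> Field P \<Longrightarrow> f p \<in> Field R" and gF: "\<And>q. q \<in> Field Q \<Longrightarrow> g q \<in> Field R"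
    and f: "\<And>p p'. p \<in> Field P \<Longrightarrow> p' \<in> Field P \<Longrightarrow> (f p, f p') \<in> R \<longleftrightarrow> (p, p') \<in> P"
    and g: "\<And>q q'. q \<in> Field Q \<Longrightarrow> q' \<in> Field Q \<Longrightarrow> (g q, g q') \<in> R \<longleftrightarrow> (q, q') \<in> Q"
    and cf: "\<And>x. x \<in> Field R \<Longrightarrow> \<exists>p\<in>Field P. (x, f p) \<in> R"
    and cg: "\<And>x. x \<in> Field R \<Longrightarrow> \<exists>q\<in>Field Q. (x, g q) \<in> R"
    using assms(1) by (elim cofinally_equivalentE) (rule that; assumption)
  obtain R' :: "('b + 'c) rel" and h k where T: "Preorder T" and R': "Preorder R'"
    and hF: "\<And>p. p \<in> Field Q \<Longrightarrow> h p \<in> Field R'" and kF: "\<And>q. q \<in> Field T \<Longrightarrow> k q \<in> Field R'"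
    and h: "\<And>p p'. p \<in> Field Q \<Longrightarrow> p' \<in> Field Q \<Longrightarrow> (h p, h p') \<in> R' \<longleftrightarrow> (p, p') \<in> Q"
    and k: "\<And>q q'. q \<in> Field T \<Longrightarrow> q' \<in> Field T \<Longrightarrow> (k q, k q') \<in> R' \<longleftrightarrow> (q, q') \<in> T"
    and ch: "\<And>x. x \<in> Field R' \<Longrightarrow> \<exists>p\<in>Field Q. (x, h p) \<in> R'"
    and ck: "\<And>x. x \<in> Field R' \<Longrightarrow> \<exists>q\<in>Field T. (x, k q) \<in> R'"
    using assms(2) by (elim cofinally_equivalentE) (rule that; assumption)
  have tr: "\<And>x y z. (x, y) \<in> R \<Longrightarrow> (y, z) \<in> R \<Longrightarrow> (x, z) \<in> R"
    using R by (meson preorder_on_def transD)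
  have tr': "\<And>x y z. (x, y) \<in> R' \<Longrightarrow> (y, z) \<in> R' \<Longrightarrow> (x, z) \<in> R'"
    using R' by (meson preorder_on_def transD)
  have gh: "\<And>q q'. q \<in> Field Q \<Longrightarrow> q' \<in> Field Q \<Longrightarrow> (g q, g q') \<in> R \<longleftrightarrow> (h q, h q') \<in> R'"
    using g h by simp
  have fI: "\<And>p p'. (p, p') \<in> P \<Longrightarrow> p \<in> Field P \<and> p' \<in> Field P \<and> (f p, f p') \<in> R"
    by (metis FieldI1 FieldI2 f)
  have kI: "\<And>t t'. (t, t') \<in> T \<Longrightarrow> t \<in> Field T \<and> t' \<in> Field T \<and> (k t, k t') \<in> R'"
    by (metis FieldI1 FieldI2 k)
  define L where "L = (\<lambda>p t. p \<in> Field P \<and> t \<in> Field T \<and>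
    (\<exists>q\<in>Field Q. (f p, g q) \<in> R \<and> (h q, k t) \<in> R'))"
  define M where "M = (\<lambda>t p. p \<in> Field P \<and> t \<in> Field T \<and>
    (\<exists>q\<in>Field Q. (k t, h q) \<in> R' \<and> (g q, f p) \<in> R))"
  show ?thesis
  proof (rule cofinally_equivalentI_rel[of P T L M])
    show "Preorder P" "Preorder T"
      by fact+
    show "\<exists>t. L p t" if "p \<in> Field P" for p
      using that fF cg hF ck unfolding L_def by blast
    show "\<exists>p. M t p" if "t \<in> Field T" for t
      using that kF ch gF cf unfolding M_def by blast
    show "L p t" if "(p, p') \<in> P" "L p' t" for p p' t
      using fI[OF that(1)] that(2) tr[of "f p" "f p'"] by (auto simp: L_def)
    show "L p t'" if "L p t" "(t, t') \<in> T" for p t t'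
      using that(1) kI[OF that(2)] tr'[of _ "k t" "k t'"] by (auto simp: L_def)
    show "M t p" if "(t, t') \<in> T" "M t' p" for t t' p
      using kI[OF that(1)] that(2) tr'[of "k t" "k t'"] by (auto simp: M_def)
    show "M t p'" if "M t p" "(p, p') \<in> P" for t p p'
      using that(1) fI[OF that(2)] tr[of _ "f p" "f p'"] by (auto simp: M_def)
    show "(p, p') \<in> P" if Lpt: "L p t" and Mtp: "M t p'" for p t p'
    proof -
      obtain q q' where q: "q \<in> Field Q" "q' \<in> Field Q" "(f p, g q) \<in> R" "(h q, k t) \<in> R'"
        "(k t, h q') \<in> R'" "(g q', f p') \<in> R"
        using Lpt Mtp by (auto simp: L_def M_def)
      then have "(g q, g q') \<in> R"
        using gh tr' by blast
      then have "(f p, f p') \<in> R"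
        using q tr by blast
      then show ?thesis
        using f Lpt Mtp by (simp add: L_def M_def)
    qed
    show "(t, t') \<in> T" if Mtp: "M t p" and Lpt: "L p t'" for t p t'
    proof -
      obtain q q' where q: "q \<in> Field Q" "q' \<in> Field Q" "(k t, h q) \<in> R'" "(g q, f p) \<in> R"
        "(f p, g q') \<in> R" "(h q', k t') \<in> R'"
        using Lpt Mtp by (auto simp: L_def M_def)
      then have "(h q, h q') \<in> R'"
        using gh tr by blast
      then have "(k t, k t') \<in> R'"
        using q tr' by blast
      then show ?thesis
        using k Lpt Mtp by (simp add: L_def M_def)
    qed
  qed (simp_all add: L_def M_def)
qed

lemma cofinal_type_eq_iff:
  assumes "Preorder P" "Preorder Q"
  shows "cofinal_type P = cofinal_type Q \<longleftrightarrow> cofinally_equivalent P Q"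
  unfolding cofinal_type_def using cofinally_equivalent_refl[OF assms(2)]
  by (auto intro: cofinally_equivalent_trans dest: cofinally_equivalent_sym)

section \<open>Cofinally scalene preorders\<close>

text \<open>
  As in the library, a cardinal is represented by a well-order \<open>\<mu>\<close> with \<^term>\<open>Card_order \<mu>\<close>;
  the condition \<open>f \<mu> \<in> \<mu>\<close> on functions in \<open>\<Prod>S\<close> becomes \<open>f \<mu> \<in> Field \<mu>\<close>.
  The library's \<open>regularCard\<close> holds of every finite cardinal.
\<close>

definition regular_cardinal :: "'a rel \<Rightarrow> bool" where
  "regular_cardinal \<mu> \<longleftrightarrow> Card_order \<mu> \<and> (\<mu> =o cone \<or> infinite (Field \<mu>) \<and> regularCard \<mu>)"

text \<open>A set of regular cardinals contains each cardinal at most once, hence the second conjunct.\<close>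

definition set_of_regular_cardinals :: "'a rel set \<Rightarrow> bool" where
  "set_of_regular_cardinals S \<longleftrightarrow>
     (\<forall>\<mu>\<in>S. regular_cardinal \<mu>) \<and> (\<forall>\<mu>\<in>S. \<forall>\<nu>\<in>S. \<mu> =o \<nu> \<longrightarrow> \<mu> = \<nu>)"

definition prod_order :: "'a rel set \<Rightarrow> ('a rel \<Rightarrow> 'a) rel" where
  "prod_order S =
     {(f, g). f \<in> Pi\<^sub>E S Field \<and> g \<in> Pi\<^sub>E S Field \<and> (\<forall>\<mu>\<in>S. (f \<mu>, g \<mu>) \<in> \<mu>)}"

text \<open>
  It is enough to consider cardinals realised on the type of \<open>P\<close>: a cardinal \<open>\<mu> \<in> S\<close>
  cannot exceed the size of \<open>P\<close> if \<open>P\<close> is cofinally equivalent to \<open>\<Prod>S\<close>; see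
  lemma \<open>cofinally_scaleneI\<close> below.
\<close>

definition cofinally_scalene :: "'a rel \<Rightarrow> bool" where
  "cofinally_scalene P \<longleftrightarrow>
     (\<exists>S :: 'a rel set. set_of_regular_cardinals S \<and> cofinally_equivalent P (prod_order S))"

lemma regular_cardinal_Card_order: "regular_cardinal \<mu> \<Longrightarrow> Card_order \<mu>"
  by (simp add: regular_cardinal_def)

lemma set_of_regular_cardinals_Card_order:
  "set_of_regular_cardinals S \<Longrightarrow> \<mu> \<in> S \<Longrightarrow> Card_order \<mu>"
  by (simp add: set_of_regular_cardinals_def regular_cardinal_def)

lemma Card_order_Preorder: "Card_order \<mu> \<Longrightarrow> Preorder \<mu>"
  by (simp add: card_order_on_def well_order_on_def linear_order_on_def partial_order_on_def)

lemma regular_cardinal_nonempty: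
  assumes "regular_cardinal \<mu>"
  shows "Field \<mu> \<noteq> {}"
proof
  assume e: "Field \<mu> = {}"
  then have "\<mu> =o cone"
    using assms by (auto simp: regular_cardinal_def)
  then obtain f where "bij_betw f (Field \<mu>) (Field cone)"
    unfolding ordIso_def iso_def by auto
  then show False
    using e by (auto simp: bij_betw_def BNF_Cardinal_Arithmetic.cone_def Field_card_of)
qed

lemma
  assumes "\<And>\<mu>. \<mu> \<in> S \<Longrightarrow> Preorder \<mu>"
  shows Field_prod_order: "Field (prod_order S) = Pi\<^sub>E S Field"
    and Preorder_prod_order: "Preorder (prod_order S)"
proof -
  have r: "(f, f) \<in> prod_order S" if "f \<in> Pi\<^sub>E S Field" for f
    using that assms by (auto simp: prod_order_def preorder_on_def refl_on_def)
  have "Pi\<^sub>E S Field \<subseteq> Field (prod_order S)"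
    using r by (meson FieldI1 subsetI)
  moreover have "Field (prod_order S) \<subseteq> Pi\<^sub>E S Field"
    unfolding Field_def by (auto simp: prod_order_def)
  ultimately show F: "Field (prod_order S) = Pi\<^sub>E S Field"
    by blast
  show "Preorder (prod_order S)"
    unfolding preorder_on_def F
  proof (intro conjI)
    show "prod_order S \<subseteq> Pi\<^sub>E S Field \<times> Pi\<^sub>E S Field"
      unfolding prod_order_def by blast
    show "refl_on (Pi\<^sub>E S Field) (prod_order S)"
      using r by (simp add: refl_on_def)
    show "trans (prod_order S)"
    proof (rule transI)
      fix f g h assume fg: "(f, g) \<in> prod_order S" and gh: "(g, h) \<in> prod_order S"
      have "(f \<mu>, h \<mu>) \<in> \<mu>" if "\<mu> \<in> S" for \<mu>
      proof -
        have "trans \<mu>" "(f \<mu>, g \<mu>) \<in> \<mu>" "(g \<mu>, h \<mu>) \<in> \<mu>"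
          using fg gh that assms[OF that] by (auto simp: prod_order_def preorder_on_def)
        then show ?thesis
          by (rule transD)
      qed
      then show "(f, h) \<in> prod_order S"
        using fg gh by (simp add: prod_order_def)
    qed
  qed
qed

lemma cofinally_equivalent_prod_order_bound:
  fixes P :: "'a rel" and S :: "'b rel set"
  assumes S: "set_of_regular_cardinals S" and PS: "cofinally_equivalent P (prod_order S)"
    and \<mu>: "\<mu> \<in> S"
  shows "|Field \<mu>| \<le>o |UNIV :: 'a set|"
proof -
  have reg: "\<And>\<nu>. \<nu> \<in> S \<Longrightarrow> regular_cardinal \<nu>"
    using S by (simp add: set_of_regular_cardinals_def)
  have C: "Card_order \<mu>"
    using reg[OF \<mu>] by (rule regular_cardinal_Card_order)
  have FS: "Field (prod_order S) = Pi\<^sub>E S Field"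
    using reg by (intro Field_prod_order Card_order_Preorder regular_cardinal_Card_order)
  consider "\<mu> =o cone" | "infinite (Field \<mu>)" "regularCard \<mu>"
    using reg[OF \<mu>] by (auto simp: regular_cardinal_def)
  then show ?thesis
  proof cases
    case 1
    have "|Field \<mu>| =o cone"
      using card_of_Field_ordIso[OF C] 1 by (rule ordIso_transitive)
    moreover have "cone \<le>o |UNIV :: 'a set|"
      unfolding BNF_Cardinal_Arithmetic.cone_def by (rule card_of_ordLeqI[of "\<lambda>_. undefined"]) auto
    ultimately show ?thesis
      by (rule ordIso_ordLeq_trans)
  next
    case 2
    obtain R :: "('a + ('b rel \<Rightarrow> 'b)) rel" and f g where R: "Preorder R"
      and fF: "\<And>p. p \<in> Field P \<Longrightarrow> f p \<in> Field R"
      and gF: "\<And>q. q \<in> Field (prod_order S) \<Longrightarrow> g q \<in> Field R"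
      and g: "\<And>q q'. q \<in> Field (prod_order S) \<Longrightarrow> q' \<in> Field (prod_order S) \<Longrightarrow>
                (g q, g q') \<in> R \<longleftrightarrow> (q, q') \<in> prod_order S"
      and cf: "\<And>x. x \<in> Field R \<Longrightarrow> \<exists>p\<in>Field P. (x, f p) \<in> R"
      and cg: "\<And>x. x \<in> Field R \<Longrightarrow> \<exists>q\<in>Field (prod_order S). (x, g q) \<in> R"
      using PS by (elim cofinally_equivalentE) (rule that; assumption)
    define b where "b = (\<lambda>\<nu>\<in>S. SOME x. x \<in> Field \<nu>)"
    define h where "h = (\<lambda>\<alpha>. b(\<mu> := \<alpha>))"
    have "b \<in> Pi\<^sub>E S Field"
      unfolding b_def using regular_cardinal_nonempty[OF reg] by (auto intro!: some_in_eq[THEN iffD2])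
    then have h: "h \<alpha> \<in> Field (prod_order S)" if "\<alpha> \<in> Field \<mu>" for \<alpha>
      unfolding FS h_def using that \<mu> by (auto simp: PiE_iff extensional_def)
    have "\<forall>\<alpha>\<in>Field \<mu>. \<exists>p\<in>Field P. (g (h \<alpha>), f p) \<in> R"
      using h gF cf by blast
    then obtain p where p: "\<And>\<alpha>. \<alpha> \<in> Field \<mu> \<Longrightarrow> p \<alpha> \<in> Field P \<and> (g (h \<alpha>), f (p \<alpha>)) \<in> R"
      by metis
    have "\<forall>x\<in>Field P. \<exists>q\<in>Field (prod_order S). (f x, g q) \<in> R"
      using fF cg by blast
    then obtain k where k: "\<And>x. x \<in> Field P \<Longrightarrow> k x \<in> Field (prod_order S) \<and> (f x, g (k x)) \<in> R"
      by metis
    define K where "K = (\<lambda>x. k x \<mu>) ` (p ` Field \<mu>)"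
    have le: "(\<alpha>, k (p \<alpha>) \<mu>) \<in> \<mu>" if \<alpha>: "\<alpha> \<in> Field \<mu>" for \<alpha>
    proof -
      have "trans R"
        using R by (simp add: preorder_on_def)
      then have "(g (h \<alpha>), g (k (p \<alpha>))) \<in> R"
        using p[OF \<alpha>] k[of "p \<alpha>"] by (blast dest: transD)
      then have "(h \<alpha>, k (p \<alpha>)) \<in> prod_order S"
        using g[of "h \<alpha>" "k (p \<alpha>)"] h[OF \<alpha>] k[of "p \<alpha>"] p[OF \<alpha>] by simp
      then have "(h \<alpha> \<mu>, k (p \<alpha>) \<mu>) \<in> \<mu>"
        using \<mu> by (simp add: prod_order_def)
      then show ?thesis
        by (simp add: h_def)
    qed
    have "K \<subseteq> Field \<mu>"
      unfolding K_def using le by (auto intro: FieldI2)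
    moreover have "cofinal K \<mu>"
      unfolding cofinal_def
    proof
      fix \<alpha> assume "\<alpha> \<in> Field \<mu>"
      then obtain \<beta> where \<beta>: "\<beta> \<in> Field \<mu>" "\<alpha> \<noteq> \<beta>" "(\<alpha>, \<beta>) \<in> \<mu>"
        using infinite_Card_order_limit[OF C 2(1)] by blast
      have "trans \<mu>" "antisym \<mu>"
        using C by (auto simp: card_order_on_def well_order_on_def linear_order_on_def
            partial_order_on_def preorder_on_def)
      then have "(\<alpha>, k (p \<beta>) \<mu>) \<in> \<mu>" "\<alpha> \<noteq> k (p \<beta>) \<mu>"
        using le[OF \<beta>(1)] \<beta> by (auto dest: transD antisymD)
      then show "\<exists>b\<in>K. \<alpha> \<noteq> b \<and> (\<alpha>, b) \<in> \<mu>"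
        unfolding K_def using \<beta>(1) by blast
    qed
    ultimately have "|K| =o \<mu>"
      using 2(2) unfolding regularCard_def by blast
    then have "|Field \<mu>| =o |K|"
      using card_of_Field_ordIso[OF C] ordIso_symmetric ordIso_transitive by blast
    also have "|K| \<le>o |p ` Field \<mu>|"
      unfolding K_def by (rule card_of_image)
    also have "|p ` Field \<mu>| \<le>o |UNIV :: 'a set|"
      by (rule card_of_mono1) simp
    finally show ?thesis .
  qed
qed

lemma cofinally_scaleneI:
  fixes P :: "'a rel" and S :: "'b rel set"
  assumes S: "set_of_regular_cardinals S" and PS: "cofinally_equivalent P (prod_order S)"
  shows "cofinally_scalene P"
proof -
  have reg: "\<And>\<mu>. \<mu> \<in> S \<Longrightarrow> regular_cardinal \<mu>"
    using S by (simp add: set_of_regular_cardinals_def)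
  have "\<forall>\<mu>\<in>S. \<exists>e :: 'b \<Rightarrow> 'a. inj_on e (Field \<mu>)"
    using cofinally_equivalent_prod_order_bound[OF S PS] by (auto simp flip: card_of_ordLeq)
  then obtain e :: "'b rel \<Rightarrow> 'b \<Rightarrow> 'a" where e: "\<And>\<mu>. \<mu> \<in> S \<Longrightarrow> inj_on (e \<mu>) (Field \<mu>)"
    by metis
  define c where "c = (\<lambda>\<mu>. dir_image \<mu> (e \<mu>))"
  have C: "Card_order \<mu>" if "\<mu> \<in> S" for \<mu>
    using reg[OF that] by (rule regular_cardinal_Card_order)
  have iso: "\<mu> =o c \<mu>" if "\<mu> \<in> S" for \<mu>
    unfolding c_def using C[OF that] e[OF that] by (intro dir_image_ordIso) (auto simp: card_order_on_def)
  have Fc: "Field (c \<mu>) = e \<mu> ` Field \<mu>" for \<mu>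
    unfolding c_def by (rule dir_image_Field)
  have rel: "(e \<mu> x, e \<mu> y) \<in> c \<mu> \<longleftrightarrow> (x, y) \<in> \<mu>"
    if "\<mu> \<in> S" "x \<in> Field \<mu>" "y \<in> Field \<mu>" for \<mu> x y
  proof
    assume "(e \<mu> x, e \<mu> y) \<in> c \<mu>"
    then obtain x' y' where xy: "(x', y') \<in> \<mu>" "e \<mu> x = e \<mu> x'" "e \<mu> y = e \<mu> y'"
      by (auto simp: c_def dir_image_def)
    have "x' \<in> Field \<mu>" "y' \<in> Field \<mu>"
      using xy(1) by (auto intro: FieldI1 FieldI2)
    then show "(x, y) \<in> \<mu>"
      using xy that inj_onD[OF e[OF that(1)], of x x'] inj_onD[OF e[OF that(1)], of y y'] by simp
  next
    assume "(x, y) \<in> \<mu>"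
    then show "(e \<mu> x, e \<mu> y) \<in> c \<mu>"
      by (auto simp: c_def dir_image_def)
  qed
  have regc: "regular_cardinal (c \<mu>)" if \<mu>: "\<mu> \<in> S" for \<mu>
  proof -
    have "Card_order (c \<mu>)"
      using C[OF \<mu>] iso[OF \<mu>] by (rule Card_order_ordIso2)
    moreover have "c \<mu> =o cone" if "\<mu> =o cone"
      using ordIso_symmetric[OF iso[OF \<mu>]] that by (rule ordIso_transitive)
    moreover have "infinite (Field (c \<mu>)) \<and> regularCard (c \<mu>)"
      if "infinite (Field \<mu>)" "regularCard \<mu>"
    proof
      show "infinite (Field (c \<mu>))"
        unfolding Fc using that(1) e[OF \<mu>] by (simp add: finite_image_iff)
      show "regularCard (c \<mu>)"
        using iso[OF \<mu>] _ that(2)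
        by (rule regularCard_ordIso) (use that(1) C[OF \<mu>] in \<open>simp add: BNF_Cardinal_Arithmetic.cinfinite_def\<close>)
    qed
    ultimately show ?thesis
      using reg[OF \<mu>] by (auto simp: regular_cardinal_def)
  qed
  have cD: "\<mu> = \<nu>" if "\<mu> \<in> S" "\<nu> \<in> S" "c \<mu> =o c \<nu>" for \<mu> \<nu>
  proof -
    have "\<mu> =o \<nu>"
      using iso[OF that(1)] that(3) ordIso_symmetric[OF iso[OF that(2)]] by (blast intro: ordIso_transitive)
    then show ?thesis
      using S that by (simp add: set_of_regular_cardinals_def)
  qed
  have inj: "inj_on c S"
  proof (rule inj_onI)
    fix \<mu> \<nu> assume "\<mu> \<in> S" "\<nu> \<in> S" "c \<mu> = c \<nu>"
    then show "\<mu> = \<nu>"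
      using cD[of \<mu> \<nu>] iso[of \<nu>] iso[of \<mu>] ordIso_symmetric ordIso_transitive by metis
  qed
  have Sc: "set_of_regular_cardinals (c ` S)"
    unfolding set_of_regular_cardinals_def using regc cD by blast
  have preS: "\<And>\<mu>. \<mu> \<in> S \<Longrightarrow> Preorder \<mu>"
    using C by (intro Card_order_Preorder)
  have preSc: "\<And>\<mu>. \<mu> \<in> c ` S \<Longrightarrow> Preorder \<mu>"
    using Sc by (intro Card_order_Preorder) (rule set_of_regular_cardinals_Card_order)
  have FS: "Field (prod_order S) = Pi\<^sub>E S Field"
    using preS by (rule Field_prod_order)
  have FSc: "Field (prod_order (c ` S)) = Pi\<^sub>E (c ` S) Field"
    using preSc by (rule Field_prod_order)
  define \<Phi> where "\<Phi> = (\<lambda>f. \<lambda>\<rho>\<in>c ` S. e (the_inv_into S c \<rho>) (f (the_inv_into S c \<rho>)))"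
  have \<Phi>c: "\<Phi> f (c \<mu>) = e \<mu> (f \<mu>)" if "\<mu> \<in> S" for f \<mu>
    using that inj by (simp add: \<Phi>_def the_inv_into_f_f)
  have \<Phi>F: "\<Phi> f \<in> Pi\<^sub>E (c ` S) Field" if "f \<in> Pi\<^sub>E S Field" for f
  proof (rule PiE_I)
    fix \<rho> assume "\<rho> \<in> c ` S"
    then obtain \<mu> where "\<mu> \<in> S" "\<rho> = c \<mu>" by blast
    then show "\<Phi> f \<rho> \<in> Field \<rho>"
      using that \<Phi>c Fc by auto
  qed (simp add: \<Phi>_def)
  have inj\<Phi>: "inj_on \<Phi> (Pi\<^sub>E S Field)"
  proof (rule inj_onI)
    fix f g assume fg: "f \<in> Pi\<^sub>E S Field" "g \<in> Pi\<^sub>E S Field" "\<Phi> f = \<Phi> g"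
    show "f = g"
    proof (rule PiE_ext[OF fg(1,2)])
      fix \<mu> assume \<mu>: "\<mu> \<in> S"
      have "e \<mu> (f \<mu>) = e \<mu> (g \<mu>)"
        using fg(3) \<Phi>c[OF \<mu>] by metis
      then show "f \<mu> = g \<mu>"
        using fg(1,2) \<mu> by (intro inj_onD[OF e[OF \<mu>]]) auto
    qed
  qed
  have "g \<in> \<Phi> ` Pi\<^sub>E S Field" if g: "g \<in> Pi\<^sub>E (c ` S) Field" for g
  proof -
    define f where "f = (\<lambda>\<mu>\<in>S. the_inv_into (Field \<mu>) (e \<mu>) (g (c \<mu>)))"
    have gc: "g (c \<mu>) \<in> e \<mu> ` Field \<mu>" if "\<mu> \<in> S" for \<mu>
      using PiE_mem[OF g, of "c \<mu>"] that unfolding Fc by blast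
    have f: "f \<in> Pi\<^sub>E S Field"
      unfolding f_def using gc e by (auto intro!: the_inv_into_into)
    have "\<Phi> f = g"
    proof (rule PiE_ext[OF \<Phi>F[OF f] g])
      fix \<rho> assume "\<rho> \<in> c ` S"
      then obtain \<mu> where "\<mu> \<in> S" "\<rho> = c \<mu>" by blast
      then show "\<Phi> f \<rho> = g \<rho>"
        using \<Phi>c[of \<mu> f] f_the_inv_into_f[OF e gc] by (simp add: f_def)
    qed
    then show ?thesis
      using f by (rule image_eqI[OF sym])
  qed
  then have img\<Phi>: "\<Phi> ` Pi\<^sub>E S Field = Pi\<^sub>E (c ` S) Field"
    by (intro equalityI image_subsetI \<Phi>F subsetI)
  have "iso (prod_order S) (Restr (prod_order (c ` S)) (Field (prod_order (c ` S)))) \<Phi>"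
    unfolding Restr_Field iso_iff2
  proof (intro conjI ballI)
    show "bij_betw \<Phi> (Field (prod_order S)) (Field (prod_order (c ` S)))"
      unfolding FS FSc bij_betw_def using inj\<Phi> img\<Phi> by (rule conjI)
  next
    fix f g assume "f \<in> Field (prod_order S)" "g \<in> Field (prod_order S)"
    then have fg: "f \<in> Pi\<^sub>E S Field" "g \<in> Pi\<^sub>E S Field"
      unfolding FS by this+
    have "(\<Phi> f (c \<mu>), \<Phi> g (c \<mu>)) \<in> c \<mu> \<longleftrightarrow> (f \<mu>, g \<mu>) \<in> \<mu>" if "\<mu> \<in> S" for \<mu>
      unfolding \<Phi>c[OF that] using PiE_mem[OF fg(1) that] PiE_mem[OF fg(2) that]
      by (rule rel[OF that])
    then show "(f, g) \<in> prod_order S \<longleftrightarrow> (\<Phi> f, \<Phi> g) \<in> prod_order (c ` S)"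
      using fg \<Phi>F by (simp add: prod_order_def)
  qed
  moreover have "iso (prod_order (c ` S)) (Restr (prod_order (c ` S)) (Field (prod_order (c ` S)))) id"
    by (simp add: iso_iff2 Restr_Field)
  moreover have pre: "Preorder (prod_order (c ` S))"
    using preSc by (rule Preorder_prod_order)
  moreover have "cofinal_subset (Field (prod_order (c ` S))) (prod_order (c ` S))"
    using pre by (auto simp: cofinal_subset_def preorder_on_def refl_on_def)
  ultimately have "cofinally_equivalent (prod_order S) (prod_order (c ` S))"
    by (blast intro: cofinally_equivalentI)
  then have "cofinally_equivalent P (prod_order (c ` S))"
    using PS cofinally_equivalent_trans by blast
  then show ?thesis
    unfolding cofinally_scalene_def using Sc by blast
qed

section \<open>Neighborhood filters\<close>

definition Nbhd :: "'a \<Rightarrow> 'a topology \<Rightarrow> 'a set set" where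
  "Nbhd p X = {U. U \<subseteq> topspace X \<and> p \<in> X interior_of U}"

definition nbhd_filter :: "'a \<Rightarrow> 'a topology \<Rightarrow> 'a set rel" where
  "nbhd_filter p X = {(U, V). U \<in> Nbhd p X \<and> V \<in> Nbhd p X \<and> U \<supseteq> V}"

definition nbhd_filters :: "'a topology \<Rightarrow> 'a set rel set" where
  "nbhd_filters X = (\<lambda>p. nbhd_filter p X) ` topspace X"

lemma Field_nbhd_filter: "Field (nbhd_filter p X) = Nbhd p X"
  unfolding Field_def nbhd_filter_def by auto

lemma Preorder_nbhd_filter: "Preorder (nbhd_filter p X)"
  unfolding preorder_on_def Field_nbhd_filter
  by (auto simp: nbhd_filter_def refl_on_def trans_def)

section \<open>The Stone-Cech compactification\<close>

text \<open>
  The standard construction: the closure of the image of \<open>X\<close> under the evaluation map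
  into the cube indexed by all continuous functions from \<open>X\<close> to \<open>[0,1]\<close>.
\<close>

definition unit_functions :: "'a topology \<Rightarrow> ('a \<Rightarrow> real) set" where
  "unit_functions X = {f \<in> extensional (topspace X). continuous_map X (top_of_set {0..1}) f}"

definition unit_cube :: "'a topology \<Rightarrow> (('a \<Rightarrow> real) \<Rightarrow> real) topology" where
  "unit_cube X = product_topology (\<lambda>_. top_of_set {0..1}) (unit_functions X)"

definition stone_cech_map :: "'a topology \<Rightarrow> 'a \<Rightarrow> ('a \<Rightarrow> real) \<Rightarrow> real" where
  "stone_cech_map X x = (\<lambda>f\<in>unit_functions X. f x)"

definition stone_cech :: "'a topology \<Rightarrow> (('a \<Rightarrow> real) \<Rightarrow> real) topology" where
  "stone_cech X =
     subtopology (unit_cube X) (unit_cube X closure_of (stone_cech_map X ` topspace X))"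

text \<open>
  For Tychonoff \<open>X\<close>, \<^term>\<open>stone_cech X\<close> with \<^term>\<open>stone_cech_map X\<close> is the
  Stone-Cech compactification: compact Hausdorff, with \<open>X\<close> densely embedded, and every continuous
  map from \<open>X\<close> to a compact Hausdorff space extends.
\<close>

lemma topspace_unit_cube: "topspace (unit_cube X) = unit_functions X \<rightarrow>\<^sub>E {0..1}"
  by (simp add: unit_cube_def)

lemma compact_space_unit_cube: "compact_space (unit_cube X)"
  by (simp add: unit_cube_def compact_space_product_topology compact_space_subtopology)

lemma Hausdorff_space_unit_cube: "Hausdorff_space (unit_cube X)"
  by (simp add: unit_cube_def Hausdorff_space_product_topology Hausdorff_space_subtopology)

lemma continuous_map_stone_cech_map: "continuous_map X (unit_cube X) (stone_cech_map X)"
  unfolding unit_cube_def continuous_map_componentwise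
proof (intro conjI ballI image_subsetI)
  show "stone_cech_map X x \<in> extensional (unit_functions X)" for x
    by (auto simp: stone_cech_map_def)
  fix f assume f: "f \<in> unit_functions X"
  then have "(\<lambda>x. stone_cech_map X x f) = f"
    by (simp add: stone_cech_map_def)
  then show "continuous_map X (top_of_set {0..1}) (\<lambda>x. stone_cech_map X x f)"
    using f by (simp add: unit_functions_def)
qed

lemma embedding_map_stone_cech_map:
  assumes "completely_regular_space X" "Hausdorff_space X"
  shows "embedding_map X (unit_cube X) (stone_cech_map X)"
proof -
  have "bounded (f ` topspace X)" if "f \<in> topspace X \<rightarrow> {0..1}" for f :: "'a \<Rightarrow> real"
    using that by (metis bounded_closed_interval bounded_subset image_subset_iff_funcset)
  then have "mspace (submetric (cfunspace X euclidean_metric) {f. f \<in> topspace X \<rightarrow> {0..1}})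
      = unit_functions X"
    by (auto simp: unit_functions_def continuous_map_in_subtopology Pi_iff)
  then show ?thesis
    using completely_regular_space_cube_embedding_explicit[OF assms]
    unfolding unit_cube_def stone_cech_map_def[abs_def] by simp
qed

lemma topspace_stone_cech:
  "topspace (stone_cech X) = unit_cube X closure_of (stone_cech_map X ` topspace X)"
  using closure_of_subset_topspace by (force simp: stone_cech_def)

lemma compact_space_stone_cech: "compact_space (stone_cech X)"
  unfolding stone_cech_def
  by (intro compact_space_subtopology closedin_compact_space compact_space_unit_cube closedin_closure_of)

lemma Hausdorff_space_stone_cech: "Hausdorff_space (stone_cech X)"
  unfolding stone_cech_def by (intro Hausdorff_space_subtopology Hausdorff_space_unit_cube)

lemma stone_cech_map_subset: "stone_cech_map X ` topspace X \<subseteq> topspace (stone_cech X)"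
  unfolding topspace_stone_cech
  using continuous_map_stone_cech_map[of X]
  by (intro closure_of_subset) (auto simp: continuous_map_def)

lemma stone_cech_map_embedding:
  assumes "completely_regular_space X" "Hausdorff_space X"
  shows "embedding_map X (stone_cech X) (stone_cech_map X)"
  using embedding_map_stone_cech_map[OF assms] stone_cech_map_subset[of X]
  unfolding topspace_stone_cech
  by (simp add: stone_cech_def embedding_map_in_subtopology)

lemma stone_cech_map_dense:
  "stone_cech X closure_of (stone_cech_map X ` topspace X) = topspace (stone_cech X)"
  using stone_cech_map_subset[of X]
  by (simp add: topspace_stone_cech) (simp add: stone_cech_def closure_of_subtopology Int_absorb1)

lemma stone_cech_extension:
  fixes X :: "'a topology" and K :: "'b topology"
  assumes K: "compact_space K" "Hausdorff_space K" and f: "continuous_map X K f"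
  obtains h where "continuous_map (stone_cech X) K h"
    "\<And>x. x \<in> topspace X \<Longrightarrow> h (stone_cech_map X x) = f x"
proof -
  define F where "F = (\<lambda>\<phi> :: ('a \<Rightarrow> real) \<Rightarrow> real. \<lambda>g\<in>unit_functions K. \<phi> (restrict (g \<circ> f) (topspace X)))"
  have gf: "restrict (g \<circ> f) (topspace X) \<in> unit_functions X" if "g \<in> unit_functions K" for g
  proof -
    have "continuous_map X (top_of_set {0..1}) (g \<circ> f)"
      using f that by (intro continuous_map_compose) (auto simp: unit_functions_def)
    then have "continuous_map X (top_of_set {0..1}) (restrict (g \<circ> f) (topspace X))"
      by (rule continuous_map_eq) auto
    then show ?thesis
      by (simp add: unit_functions_def)
  qed
  have "continuous_map (unit_cube X) (unit_cube K) F"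
    unfolding unit_cube_def[of K] continuous_map_componentwise
  proof (intro conjI ballI image_subsetI)
    show "F \<phi> \<in> extensional (unit_functions K)" for \<phi>
      by (auto simp: F_def)
    fix g assume g: "g \<in> unit_functions K"
    then have "(\<lambda>\<phi>. F \<phi> g) = (\<lambda>\<phi>. \<phi> (restrict (g \<circ> f) (topspace X)))"
      by (simp add: F_def)
    then show "continuous_map (unit_cube X) (top_of_set {0..1}) (\<lambda>\<phi>. F \<phi> g)"
      unfolding unit_cube_def using gf[OF g] by (metis continuous_map_product_projection)
  qed
  then have F: "continuous_map (unit_cube X) (unit_cube K) F" .
  have Fe: "F (stone_cech_map X x) = stone_cech_map K (f x)" if "x \<in> topspace X" for x
    using that gf by (auto simp: F_def stone_cech_map_def)
  have "completely_regular_space K"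
    using K by (intro normal_imp_completely_regular_space)
      (auto intro: compact_Hausdorff_or_regular_imp_normal_space)
  then have "embedding_map K (unit_cube K) (stone_cech_map K)"
    using K(2) by (rule embedding_map_stone_cech_map)
  then obtain r where
    r: "homeomorphic_maps K (subtopology (unit_cube K) (stone_cech_map K ` topspace K)) (stone_cech_map K) r"
    by (auto simp: embedding_map_def homeomorphic_map_maps)
  have "compactin (unit_cube K) (stone_cech_map K ` topspace K)"
    using K(1) continuous_map_stone_cech_map unfolding compact_space_def by (rule image_compactin)
  then have cl: "closedin (unit_cube K) (stone_cech_map K ` topspace K)"
    by (rule compactin_imp_closedin[OF Hausdorff_space_unit_cube])
  have "F ` (unit_cube X closure_of (stone_cech_map X ` topspace X))
      \<subseteq> unit_cube K closure_of (F ` (stone_cech_map X ` topspace X))"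
    using F by (rule continuous_map_image_closure_subset)
  also have "\<dots> \<subseteq> stone_cech_map K ` topspace K"
  proof (rule closure_of_minimal[OF _ cl])
    show "F ` stone_cech_map X ` topspace X \<subseteq> stone_cech_map K ` topspace K"
      using Fe f by (auto simp: continuous_map_def)
  qed
  finally have "F ` topspace (stone_cech X) \<subseteq> stone_cech_map K ` topspace K"
    by (simp add: topspace_stone_cech)
  moreover have "continuous_map (stone_cech X) (unit_cube K) F"
    unfolding stone_cech_def using F by (rule continuous_map_from_subtopology)
  ultimately have "continuous_map (stone_cech X)
      (subtopology (unit_cube K) (stone_cech_map K ` topspace K)) F"
    by (intro continuous_map_into_subtopology) auto
  moreover have "continuous_map (subtopology (unit_cube K) (stone_cech_map K ` topspace K)) K r"
    using r by (simp add: homeomorphic_maps_def)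
  ultimately have "continuous_map (stone_cech X) K (r \<circ> F)"
    by (rule continuous_map_compose)
  moreover have "(r \<circ> F) (stone_cech_map X x) = f x" if "x \<in> topspace X" for x
  proof -
    have "f x \<in> topspace K"
      using f that by (auto simp: continuous_map_def)
    then show ?thesis
      using Fe[OF that] r by (simp add: homeomorphic_maps_def)
  qed
  ultimately show thesis
    by (rule that)
qed

abbreviation discrete_omega :: "nat topology" where
  "discrete_omega \<equiv> discrete_topology UNIV"

definition beta_omega :: "((nat \<Rightarrow> real) \<Rightarrow> real) topology" where
  "beta_omega = stone_cech discrete_omega"

definition beta_omega_remainder :: "((nat \<Rightarrow> real) \<Rightarrow> real) topology" where
  "beta_omega_remainder =
     subtopology beta_omega (topspace beta_omega - range (stone_cech_map discrete_omega))"

section \<open>The continuum\<close>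

definition continuum :: "(nat \<Rightarrow> bool) rel" where
  "continuum = ctwo ^c natLeq"

definition CH :: bool where
  "CH \<longleftrightarrow> continuum =o cardSuc natLeq"

end

theory Submission
  imports Defs "HOL-Library.Ramsey"
begin

text \<open>
  Points of \<open>\<beta>\<omega>\<close> are ultrafilters on \<open>\<omega>\<close>. If \<open>U\<close> is the ultrafilter of a point \<open>p\<close>, the neighborhood
  filter of \<open>p\<close> in \<open>\<beta>\<omega>\<close> is cofinally equivalent to \<open>(U, \<supseteq>)\<close>, and the one in the remainder to \<open>(U, \<supseteq>\<^sup>*)\<close>,
  where \<open>A \<supseteq>\<^sup>* B\<close> means that \<open>B - A\<close> is finite. So the theorem is about Tukey types of
  ultrafilters.

  Scalene types. In a product of distinct regular cardinals every countable set is bounded in all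
  coordinates except the coordinate \<open>\<omega>\<close>; hence the product is a countable union of sets whose
  countable subsets are bounded (\<open>sigma_bounded_prod_order\<close>), and this passes to everything Tukey
  below it. If \<open>(U, \<supseteq>)\<close> is covered by such sets \<open>X n\<close>, then each \<open>\<Inter>(X n)\<close> is the intersection of a
  countable part of \<open>X n\<close>, so it lies in \<open>U\<close>, and these intersections form a countable base. A
  free ultrafilter has none, so scalene neighborhood filters in \<open>\<beta>\<omega>\<close> belong to isolated points.
  If \<open>(U, \<supseteq>\<^sup>*)\<close> is covered in this way, \<open>U\<close> is a P-point
  (\<open>sigma_bounded_almost_superset_order_P_point\<close>): otherwise some free image \<open>W\<close> of \<open>U\<close> has
  \<open>(W, \<supseteq>)\<close> Tukey below \<open>(U, \<supseteq>\<^sup>*)\<close>. For a P-point the product has no factor \<open>\<omega>\<close>, and under CH the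
  only remaining infinite factor is \<open>\<cc>\<close>.

  Many types. Under CH a binary tree of height \<open>\<omega>\<^sub>1\<close> of infinite sets, decreasing for almost
  containment, has a branch for each set of steps; along a branch all colorings of pairs become
  homogeneous, so each branch generates a Ramsey ultrafilter, and distinct branches
  generate distinct ones. This gives \<open>2\<^sup>\<cc>\<close> Ramsey ultrafilters. A monotone map defined on a Ramsey
  ultrafilter \<open>U\<close> is, below some member of \<open>U\<close>, determined by its finite approximations
  (\<open>ramsey_ultrafilter_continuous_mono\<close>), so at most \<open>\<cc>\<close> ultrafilters are Tukey below
  \<open>(U, \<supseteq>)\<close>, and the \<open>2\<^sup>\<cc>\<close> ultrafilters \<open>(U, \<supseteq>)\<close> have \<open>2\<^sup>\<cc>\<close> types. This settles \<open>\<beta>\<omega>\<close>. In the remainder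
  the same types occur: the sets of increasing pairs from members of \<open>U\<close> form a base of the square of
  \<open>U\<close>, and among them almost containment is the same as containment
  (\<open>increasing_pairs_almost_subset_iff\<close>), so the square of \<open>U\<close> ordered by \<open>\<supseteq>\<^sup>*\<close> has the type of
  \<open>(U, \<supseteq>)\<close>.
\<close>

section \<open>Tukey connections between preorders\<close>

lemma Preorder_refl: "Preorder P \<Longrightarrow> p \<in> Field P \<Longrightarrow> (p, p) \<in> P"
  by (auto simp: preorder_on_def refl_on_def)

lemma Preorder_trans: "Preorder P \<Longrightarrow> (x, y) \<in> P \<Longrightarrow> (y, z) \<in> P \<Longrightarrow> (x, z) \<in> P"
  by (meson preorder_on_def transD)

text \<open>
  The map \<open>e\<close> need not be injective, so its image need not be isomorphic to \<open>P\<close>; the common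
  preorder containing both is the disjoint union, in which \<open>p\<close> and \<open>e p\<close> are equivalent.
\<close>

lemma cofinally_equivalent_embedding:
  assumes P: "Preorder P" and Q: "Preorder Q"
    and e: "\<And>p. p \<in> Field P \<Longrightarrow> e p \<in> Field Q"
    and ord: "\<And>p p'. p \<in> Field P \<Longrightarrow> p' \<in> Field P \<Longrightarrow> (p, p') \<in> P \<longleftrightarrow> (e p, e p') \<in> Q"
    and cof: "\<And>q. q \<in> Field Q \<Longrightarrow> \<exists>p\<in>Field P. (q, e p) \<in> Q"
  shows "cofinally_equivalent P Q"
proof (rule cofinally_equivalentI_rel[of P Q "\<lambda>p q. p \<in> Field P \<and> (e p, q) \<in> Q"
      "\<lambda>q p. p \<in> Field P \<and> (q, e p) \<in> Q"])
  note tr = Preorder_trans[OF Q]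
  have PF: "p \<in> Field P \<and> p' \<in> Field P \<and> (e p, e p') \<in> Q" if "(p, p') \<in> P" for p p'
    using that ord[of p p'] by (auto intro: FieldI1 FieldI2)
  show "p \<in> Field P \<and> q \<in> Field Q" if "p \<in> Field P \<and> (e p, q) \<in> Q" for p q
    using that by (auto intro: FieldI2)
  show "q \<in> Field Q \<and> p \<in> Field P" if "p \<in> Field P \<and> (q, e p) \<in> Q" for p q
    using that by (auto intro: FieldI1)
  show "p \<in> Field P \<and> (e p, q) \<in> Q" if "(p, p') \<in> P" "p' \<in> Field P \<and> (e p', q) \<in> Q" for p p' q
    using PF[OF that(1)] that(2) tr by blast
  show "p \<in> Field P \<and> (e p, q') \<in> Q" if "p \<in> Field P \<and> (e p, q) \<in> Q" "(q, q') \<in> Q" for p q q'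
    using that tr by blast
  show "p \<in> Field P \<and> (q, e p) \<in> Q" if "(q, q') \<in> Q" "p \<in> Field P \<and> (q', e p) \<in> Q" for p q q'
    using that tr by blast
  show "p' \<in> Field P \<and> (q, e p') \<in> Q" if "p \<in> Field P \<and> (q, e p) \<in> Q" "(p, p') \<in> P" for p p' q
    using PF[OF that(2)] that(1) tr by blast
  show "(p, p') \<in> P" if "p \<in> Field P \<and> (e p, q) \<in> Q" "p' \<in> Field P \<and> (q, e p') \<in> Q" for p q p'
    using that ord tr by blast
  show "(q, q') \<in> Q" if "p \<in> Field P \<and> (q, e p) \<in> Q" "p \<in> Field P \<and> (e p, q') \<in> Q" for q p q'
    using that tr by blast
  show "\<exists>q. p \<in> Field P \<and> (e p, q) \<in> Q" if "p \<in> Field P" for p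
    using that e Preorder_refl[OF Q] by blast
  show "\<exists>p. p \<in> Field P \<and> (q, e p) \<in> Q" if "q \<in> Field Q" for q
    using cof[OF that] by blast
qed fact+

text \<open>
  Half of a cofinal equivalence, in the form in which it is used: \<open>t\<close> is a Tukey map, and \<open>s q\<close>
  is a bound for the preimage under \<open>t\<close> of the elements below \<open>q\<close>.
\<close>

definition tukey_connection :: "'a rel \<Rightarrow> 'b rel \<Rightarrow> ('a \<Rightarrow> 'b) \<Rightarrow> ('b \<Rightarrow> 'a) \<Rightarrow> bool" where
  "tukey_connection P Q t s \<longleftrightarrow>
     t \<in> Field P \<rightarrow> Field Q \<and> s \<in> Field Q \<rightarrow> Field P \<and>
     (\<forall>p\<in>Field P. \<forall>q\<in>Field Q. (t p, q) \<in> Q \<longrightarrow> (p, s q) \<in> P)"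

lemma cofinally_equivalent_tukey:
  fixes P :: "'a rel" and Q :: "'b rel"
  assumes "cofinally_equivalent P Q"
  obtains t s where "tukey_connection P Q t s"
proof -
  obtain R :: "('a + 'b) rel" and f g where R: "Preorder R"
    and fF: "\<And>p. p \<in> Field P \<Longrightarrow> f p \<in> Field R" and gF: "\<And>q. q \<in> Field Q \<Longrightarrow> g q \<in> Field R"
    and f: "\<And>p p'. p \<in> Field P \<Longrightarrow> p' \<in> Field P \<Longrightarrow> (f p, f p') \<in> R \<longleftrightarrow> (p, p') \<in> P"
    and g: "\<And>q q'. q \<in> Field Q \<Longrightarrow> q' \<in> Field Q \<Longrightarrow> (g q, g q') \<in> R \<longleftrightarrow> (q, q') \<in> Q"
    and cf: "\<And>x. x \<in> Field R \<Longrightarrow> \<exists>p\<in>Field P. (x, f p) \<in> R"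
    and cg: "\<And>x. x \<in> Field R \<Longrightarrow> \<exists>q\<in>Field Q. (x, g q) \<in> R"
    using assms by (elim cofinally_equivalentE) (rule that; assumption)
  have "\<forall>p\<in>Field P. \<exists>q\<in>Field Q. (f p, g q) \<in> R" "\<forall>q\<in>Field Q. \<exists>p\<in>Field P. (g q, f p) \<in> R"
    using fF gF cf cg by blast+
  then obtain t s where t: "\<And>p. p \<in> Field P \<Longrightarrow> t p \<in> Field Q \<and> (f p, g (t p)) \<in> R"
    and s: "\<And>q. q \<in> Field Q \<Longrightarrow> s q \<in> Field P \<and> (g q, f (s q)) \<in> R"
    by metis
  have "(p, s q) \<in> P" if "p \<in> Field P" "q \<in> Field Q" "(t p, q) \<in> Q" for p q
    using that t[OF that(1)] s[OF that(2)] f g Preorder_trans[OF R] by metis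
  then show thesis
    using t s by (intro that[of t s]) (auto simp: tukey_connection_def)
qed

section \<open>Countable unions of countably bounded sets\<close>

definition countably_bounded :: "'a set \<Rightarrow> 'a rel \<Rightarrow> bool" where
  "countably_bounded X P \<longleftrightarrow>
     (\<forall>C. C \<subseteq> X \<longrightarrow> countable C \<longrightarrow> (\<exists>q\<in>Field P. \<forall>c\<in>C. (c, q) \<in> P))"

text \<open>
  This is the property that separates products of regular cardinals from free ultrafilters. It is
  inherited downwards along Tukey maps.
\<close>

definition sigma_bounded :: "'a rel \<Rightarrow> bool" where
  "sigma_bounded P \<longleftrightarrow>
     (\<exists>X :: nat \<Rightarrow> 'a set. Field P \<subseteq> (\<Union>n. X n) \<and> (\<forall>n. X n \<subseteq> Field P \<and> countably_bounded (X n) P))"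

lemma countably_bounded_tukey:
  assumes ts: "tukey_connection P Q t s" and X: "countably_bounded X Q"
  shows "countably_bounded {p \<in> Field P. t p \<in> X} P"
  unfolding countably_bounded_def
proof (intro allI impI)
  fix C assume C: "C \<subseteq> {p \<in> Field P. t p \<in> X}" "countable C"
  then have "t ` C \<subseteq> X" "countable (t ` C)"
    by auto
  then obtain q where "q \<in> Field Q" "\<forall>c\<in>C. (t c, q) \<in> Q"
    using X unfolding countably_bounded_def by (metis imageI)
  then show "\<exists>q\<in>Field P. \<forall>c\<in>C. (c, q) \<in> P"
    using ts C(1) unfolding tukey_connection_def by (intro bexI[of _ "s q"]) auto
qed

lemma sigma_bounded_tukey:
  assumes ts: "tukey_connection P Q t s" and Q: "sigma_bounded Q"
  shows "sigma_bounded P"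
proof -
  obtain X :: "nat \<Rightarrow> _" where X: "Field Q \<subseteq> (\<Union>n. X n)" "\<And>n. countably_bounded (X n) Q"
    using Q unfolding sigma_bounded_def by blast
  have "\<exists>n. t p \<in> X n" if "p \<in> Field P" for p
    using subsetD[OF X(1), of "t p"] that ts unfolding tukey_connection_def by auto
  then have "Field P \<subseteq> (\<Union>n. {p \<in> Field P. t p \<in> X n})"
    by blast
  then show ?thesis
    unfolding sigma_bounded_def using countably_bounded_tukey[OF ts X(2)]
    by (intro exI[of _ "\<lambda>n. {p \<in> Field P. t p \<in> X n}"]) auto
qed

lemma Card_order_total:
  assumes "Card_order \<mu>" "x \<in> Field \<mu>" "y \<in> Field \<mu>"
  shows "(x, y) \<in> \<mu> \<or> (y, x) \<in> \<mu>"
proof (cases "x = y")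
  case True
  then show ?thesis
    using assms Preorder_refl[OF Card_order_Preorder] by metis
next
  case False
  then show ?thesis
    using assms unfolding card_order_on_def well_order_on_def linear_order_on_def total_on_def by blast
qed

lemma cone_Field:
  fixes \<mu> :: "'a rel"
  assumes "Card_order \<mu>" "\<mu> =o cone"
  obtains z where "Field \<mu> = {z}"
proof -
  have "|Field \<mu>| =o |{()}|"
    using ordIso_transitive[OF card_of_Field_ordIso[OF assms(1)] assms(2)]
    unfolding BNF_Cardinal_Arithmetic.cone_def .
  then obtain f :: "_ \<Rightarrow> unit" where "bij_betw f (Field \<mu>) {()}"
    by (auto simp: card_of_ordIso[symmetric])
  then have "card (Field \<mu>) = 1"
    by (simp add: bij_betw_same_card)
  then show thesis
    using that card_1_singletonE by metis
qed

lemma uncountable_regular_countably_bounded: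
  assumes reg: "regular_cardinal \<mu>" and unc: "uncountable (Field \<mu>)"
  shows "countably_bounded (Field \<mu>) \<mu>"
  unfolding countably_bounded_def
proof (intro allI impI)
  fix K assume K: "K \<subseteq> Field \<mu>" "countable K"
  have C: "Card_order \<mu>"
    using reg by (rule regular_cardinal_Card_order)
  have "infinite (Field \<mu>)"
    using unc countable_finite by blast
  moreover have "finite (Field \<mu>)" if "\<mu> =o cone"
    by (rule cone_Field[OF C that]) simp
  ultimately have r: "regularCard \<mu>"
    using reg by (auto simp: regular_cardinal_def)
  show "\<exists>q\<in>Field \<mu>. \<forall>c\<in>K. (c, q) \<in> \<mu>"
  proof (rule ccontr)
    assume no: "\<not> ?thesis"
    have "cofinal K \<mu>"
      unfolding cofinal_def
    proof
      fix a assume a: "a \<in> Field \<mu>"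
      then obtain c where c: "c \<in> K" "(c, a) \<notin> \<mu>"
        using no by blast
      then have "c \<noteq> a" "(a, c) \<in> \<mu>"
        using a K(1) Card_order_total[OF C, of a c] Preorder_refl[OF Card_order_Preorder[OF C] a]
        by auto
      then show "\<exists>b\<in>K. a \<noteq> b \<and> (a, b) \<in> \<mu>"
        using c(1) by metis
    qed
    then have "|K| =o \<mu>"
      using r K(1) unfolding regularCard_def by blast
    then have "|K| =o |Field \<mu>|"
      using card_of_Field_ordIso[OF C] ordIso_symmetric ordIso_transitive by blast
    then obtain f where "bij_betw f K (Field \<mu>)"
      by (auto simp: card_of_ordIso[symmetric])
    then have "countable (Field \<mu>)"
      using K(2) countableI_bij1 by blast
    then show False
      using unc by blast
  qed
qed

lemma countable_infinite_Card_order_natLeq: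
  fixes \<mu> :: "'a rel"
  assumes C: "Card_order \<mu>" and "countable (Field \<mu>)" "infinite (Field \<mu>)"
  shows "\<mu> =o natLeq"
proof -
  obtain f :: "_ \<Rightarrow> nat" where "bij_betw f (Field \<mu>) UNIV"
    using countableE_infinite[OF assms(2,3)] by blast
  then have "|Field \<mu>| =o |UNIV :: nat set|"
    by (auto simp: card_of_ordIso[symmetric])
  then have "|Field \<mu>| =o natLeq"
    using card_of_nat by (rule ordIso_transitive)
  with ordIso_symmetric[OF card_of_Field_ordIso[OF C]] show ?thesis
    by (rule ordIso_transitive)
qed

text \<open>
  A product of regular cardinals is a countable union of countably bounded sets: countable
  sets of functions are bounded in every coordinate except possibly in the coordinate \<open>\<omega>\<close>, which
  occurs at most once, and bounding that coordinate by each \<open>n\<close> in turn gives the cover.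
\<close>

lemma sigma_bounded_prod_order:
  assumes S: "set_of_regular_cardinals S"
  shows "sigma_bounded (prod_order S)"
proof -
  have reg: "\<And>\<nu>. \<nu> \<in> S \<Longrightarrow> regular_cardinal \<nu>"
    using S by (simp add: set_of_regular_cardinals_def)
  have C: "\<And>\<nu>. \<nu> \<in> S \<Longrightarrow> Card_order \<nu>"
    using reg by (rule regular_cardinal_Card_order)
  have FS: "Field (prod_order S) = Pi\<^sub>E S Field"
    using C by (intro Field_prod_order Card_order_Preorder)
  define X where "X n = {f \<in> Pi\<^sub>E S Field. \<forall>\<nu>\<in>S. countable (Field \<nu>) \<longrightarrow>
    (f \<nu>, from_nat_into (Field \<nu>) n) \<in> \<nu>}" for n
  have en: "from_nat_into (Field \<nu>) n \<in> Field \<nu>" if "\<nu> \<in> S" for \<nu> n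
    using regular_cardinal_nonempty[OF reg[OF that]] by (rule from_nat_into)
  have "countably_bounded (X n) (prod_order S)" for n
    unfolding countably_bounded_def
  proof (intro allI impI)
    fix K assume K: "K \<subseteq> X n" "countable K"
    have "\<exists>b\<in>Field \<nu>. \<forall>f\<in>K. (f \<nu>, b) \<in> \<nu>" if \<nu>: "\<nu> \<in> S" for \<nu>
    proof (cases "countable (Field \<nu>)")
      case True
      then show ?thesis
        using K(1) \<nu> en[OF \<nu>] unfolding X_def by blast
    next
      case False
      have "(\<lambda>f. f \<nu>) ` K \<subseteq> Field \<nu>" "countable ((\<lambda>f. f \<nu>) ` K)"
        using K \<nu> by (auto simp: X_def PiE_mem)
      then show ?thesis
        using uncountable_regular_countably_bounded[OF reg[OF \<nu>] False]
        unfolding countably_bounded_def by (metis imageI)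
    qed
    then obtain b where b: "\<And>\<nu>. \<nu> \<in> S \<Longrightarrow> b \<nu> \<in> Field \<nu> \<and> (\<forall>f\<in>K. (f \<nu>, b \<nu>) \<in> \<nu>)"
      by metis
    show "\<exists>q\<in>Field (prod_order S). \<forall>c\<in>K. (c, q) \<in> prod_order S"
      unfolding FS using b K(1)
      by (intro bexI[of _ "restrict b S"]) (auto simp: prod_order_def X_def)
  qed
  moreover have "Pi\<^sub>E S Field \<subseteq> (\<Union>n. X n)"
  proof
    fix f assume f: "f \<in> Pi\<^sub>E S Field"
    have re: "(x, x) \<in> \<nu>" if "\<nu> \<in> S" "x \<in> Field \<nu>" for x \<nu>
      using that Preorder_refl[OF Card_order_Preorder[OF C]] by blast
    have one: "(f \<nu>, from_nat_into (Field \<nu>) n) \<in> \<nu>" if \<nu>: "\<nu> \<in> S" "finite (Field \<nu>)" for \<nu> n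
    proof -
      have "\<nu> =o cone"
        using reg[OF \<nu>(1)] \<nu>(2) by (auto simp: regular_cardinal_def)
      then obtain z where "Field \<nu> = {z}"
        by (rule cone_Field[OF C[OF \<nu>(1)]])
      then show ?thesis
        using en[OF \<nu>(1), of n] PiE_mem[OF f \<nu>(1)] re[OF \<nu>(1), of z] by simp
    qed
    show "f \<in> (\<Union>n. X n)"
    proof (cases "\<exists>\<nu>\<in>S. countable (Field \<nu>) \<and> infinite (Field \<nu>)")
      case True
      then obtain \<nu> where \<nu>: "\<nu> \<in> S" "countable (Field \<nu>)" "infinite (Field \<nu>)" by blast
      have uniq: "\<rho> = \<nu>" if "\<rho> \<in> S" "countable (Field \<rho>)" "infinite (Field \<rho>)" for \<rho>
      proof -
        have "\<rho> =o \<nu>"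
          using countable_infinite_Card_order_natLeq C that \<nu> ordIso_symmetric ordIso_transitive by meson
        then show ?thesis
          using S that \<nu> by (auto simp: set_of_regular_cardinals_def)
      qed
      obtain n where "from_nat_into (Field \<nu>) n = f \<nu>"
        using from_nat_into_surj[OF \<nu>(2) PiE_mem[OF f \<nu>(1)]] by blast
      then have "f \<in> X n"
        unfolding X_def using f one uniq re[OF \<nu>(1) PiE_mem[OF f \<nu>(1)]] by auto metis
      then show ?thesis by blast
    next
      case False
      then have "f \<in> X 0"
        unfolding X_def using f one by auto
      then show ?thesis by blast
    qed
  qed
  ultimately show ?thesis
    unfolding sigma_bounded_def FS by (intro exI[of _ X]) (auto simp: X_def)
qed

section \<open>Ultrafilters on the natural numbers\<close>

text \<open>The second conjunct makes the filter proper and maximal at once.\<close>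

definition nat_ultrafilter :: "nat set set \<Rightarrow> bool" where
  "nat_ultrafilter U \<longleftrightarrow>
     (\<forall>A B. A \<inter> B \<in> U \<longleftrightarrow> A \<in> U \<and> B \<in> U) \<and> (\<forall>A. - A \<in> U \<longleftrightarrow> A \<notin> U)"

definition free_ultrafilter :: "nat set set \<Rightarrow> bool" where
  "free_ultrafilter U \<longleftrightarrow> nat_ultrafilter U \<and> (\<forall>n. {n} \<notin> U)"

definition superset_order :: "nat set set \<Rightarrow> nat set rel" where
  "superset_order U = {(A, B). A \<in> U \<and> B \<in> U \<and> B \<subseteq> A}"

definition almost_superset_order :: "nat set set \<Rightarrow> nat set rel" where
  "almost_superset_order U = {(A, B). A \<in> U \<and> B \<in> U \<and> finite (B - A)}"

lemma Field_superset_order: "Field (superset_order U) = U"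
  unfolding superset_order_def Field_def by auto

lemma Preorder_superset_order: "Preorder (superset_order U)"
  unfolding preorder_on_def Field_superset_order
  by (auto simp: superset_order_def refl_on_def trans_def)

lemma Field_almost_superset_order: "Field (almost_superset_order U) = U"
  unfolding almost_superset_order_def Field_def by force

lemma finite_Diff_trans: "finite (A - B) \<Longrightarrow> finite (B - C) \<Longrightarrow> finite (A - C)"
  by (rule finite_subset[of _ "(A - B) \<union> (B - C)"]) auto

lemma Preorder_almost_superset_order: "Preorder (almost_superset_order U)"
  unfolding preorder_on_def Field_almost_superset_order
  by (auto simp: almost_superset_order_def refl_on_def trans_def intro: finite_Diff_trans)

lemma nat_ultrafilter_Int: "nat_ultrafilter U \<Longrightarrow> A \<inter> B \<in> U \<longleftrightarrow> A \<in> U \<and> B \<in> U"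
  and nat_ultrafilter_Compl: "nat_ultrafilter U \<Longrightarrow> - A \<in> U \<longleftrightarrow> A \<notin> U"
  by (auto simp: nat_ultrafilter_def)

lemma nat_ultrafilter_mono: "nat_ultrafilter U \<Longrightarrow> A \<in> U \<Longrightarrow> A \<subseteq> B \<Longrightarrow> B \<in> U"
  by (metis Int_absorb2 nat_ultrafilter_Int)

lemma nat_ultrafilter_empty: "nat_ultrafilter U \<Longrightarrow> {} \<notin> U"
  by (metis Compl_disjoint nat_ultrafilter_Compl nat_ultrafilter_Int)

lemma nat_ultrafilter_UNIV: "nat_ultrafilter U \<Longrightarrow> UNIV \<in> U"
  by (metis Compl_empty_eq nat_ultrafilter_Compl nat_ultrafilter_empty)

lemma nat_ultrafilter_Un: "nat_ultrafilter U \<Longrightarrow> A \<union> B \<in> U \<Longrightarrow> A \<in> U \<or> B \<in> U"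
  by (metis Compl_Un nat_ultrafilter_Compl nat_ultrafilter_Int)

lemma nat_ultrafilter_INT:
  assumes "nat_ultrafilter U" "finite I" "\<And>i. i \<in> I \<Longrightarrow> A i \<in> U"
  shows "(\<Inter>i\<in>I. A i) \<in> U"
  using assms(2,3)
  by (induction I) (auto simp: nat_ultrafilter_Int[OF assms(1)] nat_ultrafilter_UNIV[OF assms(1)])

lemma free_ultrafilter_infinite:
  assumes "free_ultrafilter U" "A \<in> U"
  shows "infinite A"
proof
  assume "finite A"
  then show False
    using assms(2)
  proof (induction A)
    case empty
    then show ?case
      using assms(1) nat_ultrafilter_empty unfolding free_ultrafilter_def by blast
  next
    case (insert x A)
    then have "{x} \<union> A \<in> U" by simp
    then show ?case
      using insert.IH assms(1) nat_ultrafilter_Un unfolding free_ultrafilter_def by blast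
  qed
qed

lemma free_ultrafilter_Diff_finite:
  assumes U: "free_ultrafilter U" and "A \<in> U" "finite F"
  shows "A - F \<in> U"
proof -
  have u: "nat_ultrafilter U"
    using U by (simp add: free_ultrafilter_def)
  have "F \<notin> U"
    using free_ultrafilter_infinite[OF U] assms(3) by blast
  then show ?thesis
    using assms(2) nat_ultrafilter_Int[OF u, of A "- F"] nat_ultrafilter_Compl[OF u] by (simp add: Diff_eq)
qed

lemma strict_mono_selection:
  fixes E :: "nat \<Rightarrow> nat set"
  assumes "\<And>n. infinite (E n)"
  obtains x where "strict_mono x" "\<And>n. x n \<in> E n"
proof -
  have ex: "\<exists>y. y \<in> E n \<and> k < y" for n k
    using assms[of n] by (meson infinite_nat_iff_unbounded)
  define x where "x = rec_nat (SOME y. y \<in> E 0) (\<lambda>n k. SOME y. y \<in> E (Suc n) \<and> k < y)"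
  have "x (Suc n) \<in> E (Suc n) \<and> x n < x (Suc n)" for n
    using someI_ex[OF ex[of "Suc n" "x n"]] by (simp add: x_def)
  moreover have "x 0 \<in> E 0"
    using ex[of 0 0] by (auto simp: x_def intro: someI)
  ultimately show thesis
    by (intro that[of x]) (auto simp: strict_mono_Suc_iff, metis not0_implies_Suc)
qed

text \<open>
  Pick two points from each of countably many members of the ultrafilter, all distinct. A set that
  contains all the first points and none of the second ones lies in the ultrafilter, or its complement
  does; but neither of the two includes any of the given members.
\<close>

lemma free_ultrafilter_no_countable_base:
  fixes D :: "nat \<Rightarrow> nat set"
  assumes U: "free_ultrafilter U" and D: "\<And>n. D n \<in> U"
  obtains A where "A \<in> U" "\<And>n. \<not> D n \<subseteq> A"
proof -
  have "\<And>n. infinite (D (n div 2))"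
    using free_ultrafilter_infinite[OF U D] .
  then obtain x where x: "strict_mono x" "\<And>n. x n \<in> D (n div 2)"
    using strict_mono_selection[of "\<lambda>n. D (n div 2)"] by blast
  define A where "A = range (\<lambda>n. x (2 * n))"
  have in1: "x (2 * n) \<in> D n \<inter> A" for n
    using x(2)[of "2 * n"] by (auto simp: A_def)
  have in2: "x (2 * n + 1) \<in> D n - A" for n
    using x(2)[of "2 * n + 1"] strict_mono_eq[OF x(1)] by (auto simp: A_def) presburger
  have "A \<in> U \<or> - A \<in> U"
    using U nat_ultrafilter_Compl by (auto simp: free_ultrafilter_def)
  then show thesis
    using that[of A] that[of "- A"] in1 in2 by blast
qed

lemma superset_order_not_sigma_bounded:
  assumes U: "free_ultrafilter U"
  shows "\<not> sigma_bounded (superset_order U)"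
proof
  assume "sigma_bounded (superset_order U)"
  then obtain X :: "nat \<Rightarrow> nat set set" where X: "U \<subseteq> (\<Union>n. X n)" "\<And>n. X n \<subseteq> U"
    "\<And>n. countably_bounded (X n) (superset_order U)"
    unfolding sigma_bounded_def Field_superset_order by blast
  have u: "nat_ultrafilter U"
    using U by (simp add: free_ultrafilter_def)
  \<comment> \<open>The intersection of \<open>X n\<close> is already the intersection of a countable part of \<open>X n\<close>.\<close>
  have "\<Inter>(X n) \<in> U" for n
  proof -
    have "\<forall>k. \<exists>A. k \<notin> \<Inter>(X n) \<longrightarrow> A \<in> X n \<and> k \<notin> A"
      by blast
    then obtain A where A: "\<And>k. k \<notin> \<Inter>(X n) \<Longrightarrow> A k \<in> X n \<and> k \<notin> A k"
      by metis
    have "countable (A ` (- \<Inter>(X n)))" "A ` (- \<Inter>(X n)) \<subseteq> X n"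
      using A by auto
    then obtain B where B: "B \<in> U" "\<forall>c\<in>A ` (- \<Inter>(X n)). (c, B) \<in> superset_order U"
      using X(3) unfolding countably_bounded_def Field_superset_order by meson
    then have "B \<subseteq> \<Inter>(X n)"
      using A unfolding superset_order_def by blast
    then show ?thesis
      using nat_ultrafilter_mono[OF u B(1)] by blast
  qed
  then obtain A where "A \<in> U" "\<And>n. \<not> \<Inter>(X n) \<subseteq> A"
    using free_ultrafilter_no_countable_base[OF U, where D = "\<lambda>n. \<Inter>(X n)"] by blast
  then show False
    using X(1) by blast
qed

text \<open>
  If \<open>A k\<close> witnesses that \<open>U\<close> is not a P-point, the map \<open>h\<close> sending \<open>m\<close> to the first \<open>k\<close> with
  \<open>m \<notin> A k\<close> pushes \<open>U\<close> forward to a free ultrafilter \<open>W\<close>. On the one side preimages of members of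
  \<open>W\<close> lie in \<open>U\<close>; on the other side, the set of the \<open>k\<close> over which \<open>Z \<in> U\<close> has an infinite
  fibre lies in \<open>W\<close>, and it depends only on \<open>Z\<close> modulo finite sets. So \<open>W\<close>, ordered by plain
  containment, is Tukey below \<open>U\<close> ordered by almost containment.
\<close>

lemma sigma_bounded_almost_superset_order_P_point:
  assumes U: "free_ultrafilter U" and sb: "sigma_bounded (almost_superset_order U)"
  shows "countably_bounded U (almost_superset_order U)"
proof (rule ccontr)
  assume "\<not> ?thesis"
  then obtain C where C: "C \<subseteq> U" "countable C"
    and unb: "\<not> (\<exists>B\<in>U. \<forall>A\<in>C. (A, B) \<in> almost_superset_order U)"
    unfolding countably_bounded_def Field_almost_superset_order by meson
  have C3: "\<exists>A\<in>C. infinite (B - A)" if "B \<in> U" for B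
    using unb C(1) that unfolding almost_superset_order_def by auto
  have u: "nat_ultrafilter U"
    using U by (simp add: free_ultrafilter_def)
  have "C \<noteq> {}"
    using C3 nat_ultrafilter_UNIV[OF u] by blast
  then obtain A :: "nat \<Rightarrow> nat set" where A: "C = range A"
    using C(2) uncountable_def by blast
  have AU: "A k \<in> U" for k
    using C(1) A by blast
  have noA: "\<exists>k. infinite (B - A k)" if "B \<in> U" for B
    using C3[OF that] A by blast
  define D where "D = (\<Inter>k. A k)"
  have "D - A k = {}" for k
    by (auto simp: D_def)
  then have D: "- D \<in> U"
    unfolding nat_ultrafilter_Compl[OF u] using noA[of D] by (metis finite.emptyI)
  define h where "h m = (LEAST k. m \<notin> A k)" for m
  have h: "m \<notin> A (h m)" if "m \<notin> D" for m
    using that unfolding h_def D_def by (metis INT_I LeastI_ex)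
  have h': "h m \<le> k" if "m \<notin> A k" for m k
    using that unfolding h_def by (rule Least_le)
  define W where "W = {B. h -` B \<in> U}"
  have W: "nat_ultrafilter W"
    unfolding nat_ultrafilter_def W_def
    by (simp add: nat_ultrafilter_Int[OF u] nat_ultrafilter_Compl[OF u] vimage_Compl)
  have "{k} \<notin> W" for k
  proof
    assume "{k} \<in> W"
    then have "h -` {k} \<inter> (A k \<inter> - D) \<in> U"
      using AU D by (simp add: W_def nat_ultrafilter_Int[OF u])
    moreover have "h -` {k} \<inter> (A k \<inter> - D) = {}"
      using h by auto
    ultimately show False
      using nat_ultrafilter_empty[OF u] by simp
  qed
  then have Wf: "free_ultrafilter W"
    using W by (simp add: free_ultrafilter_def)
  define s where "s Z = {k. infinite (Z \<inter> h -` {k})}" for Z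
  have "s Z \<in> W" if Z: "Z \<in> U" for Z
  proof (rule ccontr)
    assume "s Z \<notin> W"
    then have "h -` (- s Z) \<in> U"
      using nat_ultrafilter_Compl[OF W, of "s Z"] by (simp add: W_def)
    then have "Z \<inter> - D \<inter> h -` (- s Z) \<in> U"
      using Z D by (simp add: nat_ultrafilter_Int[OF u])
    then obtain k where k: "infinite (Z \<inter> - D \<inter> h -` (- s Z) - A k)"
      using noA by blast
    have "Z \<inter> - D \<inter> h -` (- s Z) - A k \<subseteq> (\<Union>j\<in>{..k} - s Z. Z \<inter> h -` {j})"
      using h' by auto
    moreover have "finite (\<Union>j\<in>{..k} - s Z. Z \<inter> h -` {j})"
      by (intro finite_UN_I) (auto simp: s_def)
    ultimately show False
      using k finite_subset by blast
  qed
  moreover have "s Z \<subseteq> B" if "finite (Z - h -` B)" for Z B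
  proof
    fix k assume "k \<in> s Z"
    then have "infinite (Z \<inter> h -` {k})"
      by (simp add: s_def)
    then have "\<not> Z \<inter> h -` {k} \<subseteq> Z - h -` B"
      using finite_subset[OF _ that] by metis
    then show "k \<in> B" by auto
  qed
  moreover have "h -` B \<in> U" if "B \<in> W" for B
    using that by (simp add: W_def)
  ultimately have "tukey_connection (superset_order W) (almost_superset_order U) (\<lambda>B. h -` B) s"
    unfolding tukey_connection_def Field_superset_order Field_almost_superset_order
    by (simp add: superset_order_def almost_superset_order_def)
  then have "sigma_bounded (superset_order W)"
    using sb by (rule sigma_bounded_tukey)
  then show False
    using superset_order_not_sigma_bounded[OF Wf] by contradiction
qed

section \<open>Points of the compactification as ultrafilters\<close>

abbreviation omega_point :: "nat \<Rightarrow> (nat \<Rightarrow> real) \<Rightarrow> real" where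
  "omega_point \<equiv> stone_cech_map discrete_omega"

definition char_fun :: "nat set \<Rightarrow> nat \<Rightarrow> real" where
  "char_fun A n = (if n \<in> A then 1 else 0)"

text \<open>
  A point \<open>p\<close> of \<open>\<beta>\<omega>\<close> assigns to a bounded function its limit along an ultrafilter; a set belongs to
  the ultrafilter iff its characteristic function has limit 1.
\<close>

definition ultrafilter_of :: "((nat \<Rightarrow> real) \<Rightarrow> real) \<Rightarrow> nat set set" where
  "ultrafilter_of p = {A. p (char_fun A) = 1}"

definition clopen_of :: "nat set \<Rightarrow> ((nat \<Rightarrow> real) \<Rightarrow> real) set" where
  "clopen_of A = {p \<in> topspace beta_omega. A \<in> ultrafilter_of p}"

lemma char_fun_unit_functions: "char_fun A \<in> unit_functions discrete_omega"
  by (auto simp: unit_functions_def char_fun_def)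

lemma omega_point_in: "omega_point n \<in> topspace beta_omega"
  using stone_cech_map_subset[of discrete_omega] by (auto simp: beta_omega_def)

lemma ultrafilter_of_omega_point: "ultrafilter_of (omega_point n) = {A. n \<in> A}"
  using char_fun_unit_functions by (auto simp: ultrafilter_of_def stone_cech_map_def char_fun_def)

lemma omega_point_clopen_of [simp]: "omega_point n \<in> clopen_of A \<longleftrightarrow> n \<in> A"
  by (simp add: clopen_of_def omega_point_in ultrafilter_of_omega_point)

lemma clopen_of_subset: "clopen_of A \<subseteq> topspace beta_omega"
  by (auto simp: clopen_of_def)

lemma Hausdorff_beta_omega: "Hausdorff_space beta_omega"
  and compact_beta_omega: "compact_space beta_omega"
  by (simp_all add: beta_omega_def Hausdorff_space_stone_cech compact_space_stone_cech)

lemma open_contains_omega_point: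
  assumes "openin beta_omega G" "p \<in> G"
  obtains n where "omega_point n \<in> G"
proof -
  have "p \<in> beta_omega closure_of range omega_point"
    using stone_cech_map_dense[of discrete_omega] openin_subset[OF assms(1)] assms(2)
    by (auto simp: beta_omega_def)
  then show thesis
    using assms that unfolding in_closure_of by blast
qed

lemma continuous_map_eval_char_fun: "continuous_map beta_omega euclideanreal (\<lambda>p. p (char_fun A))"
proof -
  have "continuous_map (unit_cube discrete_omega) (top_of_set {0..1::real}) (\<lambda>p. p (char_fun A))"
    unfolding unit_cube_def by (rule continuous_map_product_projection[OF char_fun_unit_functions])
  then have "continuous_map beta_omega (top_of_set {0..1::real}) (\<lambda>p. p (char_fun A))"
    unfolding beta_omega_def stone_cech_def by (rule continuous_map_from_subtopology)
  then show ?thesis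
    by (simp add: continuous_map_in_subtopology)
qed

lemma eval_char_fun:
  assumes "p \<in> topspace beta_omega"
  shows "p (char_fun A) \<in> {0, 1}"
proof (rule ccontr)
  assume "p (char_fun A) \<notin> {0, 1}"
  moreover have "openin beta_omega {p \<in> topspace beta_omega. p (char_fun A) \<in> - {0, 1}}"
    using continuous_map_eval_char_fun by (rule openin_continuous_map_preimage) auto
  ultimately obtain n where "omega_point n (char_fun A) \<in> - {0, 1}"
    using assms by (elim open_contains_omega_point[where p = p]) auto
  then show False
    using char_fun_unit_functions by (auto simp: stone_cech_map_def char_fun_def split: if_splits)
qed

lemma openin_clopen_of: "openin beta_omega (clopen_of A)"
proof -
  have "A \<in> ultrafilter_of p \<longleftrightarrow> 0 < p (char_fun A)" if "p \<in> topspace beta_omega" for p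
    using eval_char_fun[OF that, of A] by (auto simp: ultrafilter_of_def)
  then have "clopen_of A = {p \<in> topspace beta_omega. p (char_fun A) \<in> {0<..}}"
    by (auto simp: clopen_of_def)
  then show ?thesis
    using openin_continuous_map_preimage[OF continuous_map_eval_char_fun, of "{0<..}"] by simp
qed

lemma closedin_clopen_of: "closedin beta_omega (clopen_of A)"
proof -
  have "clopen_of A = {p \<in> topspace beta_omega. p (char_fun A) \<in> {1}}"
    by (auto simp: clopen_of_def ultrafilter_of_def)
  then show ?thesis
    using closedin_continuous_map_preimage[OF continuous_map_eval_char_fun, of "{1}"] by simp
qed

text \<open>By density, relations between clopen sets can be checked on the points of \<open>\<omega>\<close>.\<close>

lemma open_subset_closed_beta_omega:
  assumes "openin beta_omega G" "closedin beta_omega F" "\<And>n. omega_point n \<in> G \<Longrightarrow> omega_point n \<in> F"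
  shows "G \<subseteq> F"
proof (rule ccontr)
  assume "\<not> G \<subseteq> F"
  then obtain p where "p \<in> G - F" by blast
  then show False
    using open_contains_omega_point[OF openin_diff[OF assms(1,2)]] assms(3) by blast
qed

lemma clopen_of_Int: "clopen_of (A \<inter> B) = clopen_of A \<inter> clopen_of B"
proof
  show "clopen_of (A \<inter> B) \<subseteq> clopen_of A \<inter> clopen_of B"
    by (rule open_subset_closed_beta_omega) (auto simp: openin_clopen_of closedin_clopen_of)
  show "clopen_of A \<inter> clopen_of B \<subseteq> clopen_of (A \<inter> B)"
    by (rule open_subset_closed_beta_omega) (auto simp: openin_clopen_of closedin_clopen_of)
qed

lemma clopen_of_Compl: "clopen_of (- A) = topspace beta_omega - clopen_of A"
proof
  show "clopen_of (- A) \<subseteq> topspace beta_omega - clopen_of A"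
    by (rule open_subset_closed_beta_omega[OF openin_clopen_of
          closedin_diff[OF closedin_topspace openin_clopen_of]]) (simp add: omega_point_in)
  show "topspace beta_omega - clopen_of A \<subseteq> clopen_of (- A)"
    by (rule open_subset_closed_beta_omega[OF openin_diff[OF openin_topspace closedin_clopen_of]
          closedin_clopen_of]) simp
qed

lemma clopen_of_subset_iff: "clopen_of A \<subseteq> clopen_of B \<longleftrightarrow> A \<subseteq> B"
proof
  assume "A \<subseteq> B"
  then show "clopen_of A \<subseteq> clopen_of B"
    by (metis clopen_of_Int inf.absorb_iff2 inf.orderE inf_le2)
next
  assume "clopen_of A \<subseteq> clopen_of B"
  then show "A \<subseteq> B"
    by (meson omega_point_clopen_of subsetD subsetI)
qed

lemma nat_ultrafilter_ultrafilter_of: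
  assumes "p \<in> topspace beta_omega"
  shows "nat_ultrafilter (ultrafilter_of p)"
proof -
  have i: "A \<in> ultrafilter_of p \<longleftrightarrow> p \<in> clopen_of A" for A
    using assms by (simp add: clopen_of_def)
  show ?thesis
    unfolding nat_ultrafilter_def i using assms by (simp add: clopen_of_Int clopen_of_Compl)
qed

lemma clopen_of_base:
  assumes G: "openin beta_omega G" "p \<in> G"
  obtains A where "A \<in> ultrafilter_of p" "clopen_of A \<subseteq> G"
proof -
  have "regular_space beta_omega"
    using compact_beta_omega Hausdorff_beta_omega
    by (auto intro: compact_Hausdorff_imp_regular_space)
  then obtain V K where V: "openin beta_omega V" "closedin beta_omega K" "p \<in> V" "V \<subseteq> K" "K \<subseteq> G"
    using G unfolding neighbourhood_base_of_closedin[symmetric] neighbourhood_base_of by meson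
  define A where "A = {n. omega_point n \<in> V}"
  have "V \<subseteq> clopen_of A"
    by (rule open_subset_closed_beta_omega[OF V(1) closedin_clopen_of]) (simp add: A_def)
  moreover have "clopen_of A \<subseteq> K"
    by (rule open_subset_closed_beta_omega[OF openin_clopen_of V(2)]) (use V(4) in \<open>auto simp: A_def\<close>)
  ultimately show thesis
    using V by (intro that[of A]) (auto simp: clopen_of_def)
qed

lemma clopen_of_singleton: "clopen_of {n} = {omega_point n}"
proof -
  have "closedin beta_omega {omega_point n}"
    using closedin_Hausdorff_singleton[OF Hausdorff_beta_omega omega_point_in] .
  then have "clopen_of {n} \<subseteq> {omega_point n}"
    by (intro open_subset_closed_beta_omega) (auto simp: openin_clopen_of)
  then show ?thesis by auto
qed

lemma inj_on_ultrafilter_of: "inj_on ultrafilter_of (topspace beta_omega)"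
proof (rule inj_onI, rule ccontr)
  fix p q assume pq: "p \<in> topspace beta_omega" "q \<in> topspace beta_omega"
    "ultrafilter_of p = ultrafilter_of q" "p \<noteq> q"
  then have "openin beta_omega (topspace beta_omega - {q})" "p \<in> topspace beta_omega - {q}"
    using closedin_Hausdorff_singleton[OF Hausdorff_beta_omega] by auto
  then obtain A where "A \<in> ultrafilter_of p" "clopen_of A \<subseteq> topspace beta_omega - {q}"
    by (rule clopen_of_base)
  then show False
    using pq by (auto simp: clopen_of_def)
qed

lemma ultrafilter_of_surj:
  assumes U: "nat_ultrafilter U"
  obtains p where "p \<in> topspace beta_omega" "ultrafilter_of p = U"
proof -
  have fin: "\<Inter>F \<noteq> {}" if F: "finite F" "F \<subseteq> clopen_of ` U" for F
  proof -
    obtain I where I: "I \<subseteq> U" "finite I" "F = clopen_of ` I"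
      using finite_subset_image[OF F] by blast
    have "(\<Inter>A\<in>I. A) \<in> U"
      by (rule nat_ultrafilter_INT[OF U I(2)]) (use I(1) in blast)
    then have "(\<Inter>A\<in>I. A) \<noteq> {}"
      using nat_ultrafilter_empty[OF U] by auto
    then obtain n where "n \<in> (\<Inter>A\<in>I. A)" by blast
    then have "omega_point n \<in> \<Inter>F"
      unfolding I(3) by auto
    then show ?thesis by blast
  qed
  have "\<Inter>(clopen_of ` U) \<noteq> {}"
    using compact_beta_omega fin closedin_clopen_of unfolding compact_space_fip by blast
  then obtain p where p: "\<And>A. A \<in> U \<Longrightarrow> p \<in> clopen_of A"
    by blast
  then have pt: "p \<in> topspace beta_omega"
    using nat_ultrafilter_UNIV[OF U] clopen_of_subset by blast
  have 1: "A \<in> ultrafilter_of p" if "A \<in> U" for A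
    using p[OF that] by (simp add: clopen_of_def)
  have "A \<in> U" if "A \<in> ultrafilter_of p" for A
    using 1[of "- A"] that nat_ultrafilter_Compl[OF U]
      nat_ultrafilter_Compl[OF nat_ultrafilter_ultrafilter_of[OF pt]] by blast
  then show thesis
    using 1 pt by (intro that) auto
qed

lemma topspace_beta_omega_remainder:
  "topspace beta_omega_remainder = {p \<in> topspace beta_omega. free_ultrafilter (ultrafilter_of p)}"
proof -
  have "{n} \<in> ultrafilter_of p \<longleftrightarrow> p = omega_point n" if "p \<in> topspace beta_omega" for p n
    using that clopen_of_singleton[of n] by (auto simp: clopen_of_def)
  then show ?thesis
    using nat_ultrafilter_ultrafilter_of
    by (auto simp: beta_omega_remainder_def free_ultrafilter_def)
qed

lemma clopen_of_remainder_subset_iff: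
  "clopen_of A \<inter> topspace beta_omega_remainder \<subseteq> clopen_of B \<inter> topspace beta_omega_remainder
     \<longleftrightarrow> finite (A - B)"
proof
  assume fin: "finite (A - B)"
  show "clopen_of A \<inter> topspace beta_omega_remainder \<subseteq> clopen_of B \<inter> topspace beta_omega_remainder"
  proof
    fix p assume p: "p \<in> clopen_of A \<inter> topspace beta_omega_remainder"
    then have f: "free_ultrafilter (ultrafilter_of p)" "A \<in> ultrafilter_of p"
      by (auto simp: topspace_beta_omega_remainder clopen_of_def)
    then have "A - (A - B) \<in> ultrafilter_of p"
      using fin by (rule free_ultrafilter_Diff_finite)
    then have "B \<in> ultrafilter_of p"
      using nat_ultrafilter_mono f(1) by (auto simp: free_ultrafilter_def)
    then show "p \<in> clopen_of B \<inter> topspace beta_omega_remainder"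
      using p by (auto simp: clopen_of_def)
  qed
next
  assume sub: "clopen_of A \<inter> topspace beta_omega_remainder \<subseteq> clopen_of B \<inter> topspace beta_omega_remainder"
  \<comment> \<open>A clopen set missing the remainder is a compact set of isolated points.\<close>
  have "clopen_of (A - B) \<inter> topspace beta_omega_remainder = {}"
    using sub by (auto simp: Diff_eq clopen_of_Int clopen_of_Compl)
  then have cov: "clopen_of (A - B) \<subseteq> \<Union>(range (\<lambda>n. clopen_of {n}))"
    using clopen_of_subset[of "A - B"]
    by (auto simp: beta_omega_remainder_def clopen_of_singleton)
  have "compactin beta_omega (clopen_of (A - B))"
    using closedin_compact_space[OF compact_beta_omega closedin_clopen_of] .
  then obtain F where F: "finite F" "F \<subseteq> range (\<lambda>n. clopen_of {n})" "clopen_of (A - B) \<subseteq> \<Union>F"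
    using cov openin_clopen_of compactinD[of beta_omega "clopen_of (A - B)" "range (\<lambda>n. clopen_of {n})"] by blast
  obtain I where I: "finite I" "F = (\<lambda>n. clopen_of {n}) ` I"
    using finite_subset_image[OF F(1,2)] by blast
  have "A - B \<subseteq> I"
  proof
    fix n assume "n \<in> A - B"
    then have "omega_point n \<in> clopen_of (A - B)" by simp
    then obtain m where "m \<in> I" "omega_point n \<in> clopen_of {m}"
      using F(3) I(2) by blast
    then show "n \<in> I" by simp
  qed
  then show "finite (A - B)"
    using I(1) finite_subset by blast
qed

lemma Nbhd_beta_omega:
  assumes p: "p \<in> topspace beta_omega"
  shows "N \<in> Nbhd p beta_omega \<longleftrightarrow> N \<subseteq> topspace beta_omega \<and> (\<exists>A\<in>ultrafilter_of p. clopen_of A \<subseteq> N)"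
proof
  assume N: "N \<in> Nbhd p beta_omega"
  then have "p \<in> beta_omega interior_of N" by (simp add: Nbhd_def)
  then obtain A where "A \<in> ultrafilter_of p" "clopen_of A \<subseteq> beta_omega interior_of N"
    using clopen_of_base[OF openin_interior_of] by metis
  then show "N \<subseteq> topspace beta_omega \<and> (\<exists>A\<in>ultrafilter_of p. clopen_of A \<subseteq> N)"
    using N interior_of_subset[of beta_omega N] unfolding Nbhd_def by blast
next
  assume "N \<subseteq> topspace beta_omega \<and> (\<exists>A\<in>ultrafilter_of p. clopen_of A \<subseteq> N)"
  then obtain A where A: "N \<subseteq> topspace beta_omega" "A \<in> ultrafilter_of p" "clopen_of A \<subseteq> N"
    by blast
  then have "p \<in> clopen_of A"
    using p by (simp add: clopen_of_def)
  then show "N \<in> Nbhd p beta_omega"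
    using A openin_clopen_of unfolding Nbhd_def interior_of_def by blast
qed

lemma Nbhd_beta_omega_remainder:
  assumes p: "p \<in> topspace beta_omega_remainder"
  shows "N \<in> Nbhd p beta_omega_remainder \<longleftrightarrow> N \<subseteq> topspace beta_omega_remainder \<and>
    (\<exists>A\<in>ultrafilter_of p. clopen_of A \<inter> topspace beta_omega_remainder \<subseteq> N)"
proof -
  let ?R = "topspace beta_omega_remainder"
  have R: "openin beta_omega_remainder G \<longleftrightarrow> (\<exists>H. openin beta_omega H \<and> G = H \<inter> ?R)" for G
    by (auto simp: beta_omega_remainder_def openin_subtopology)
  have pt: "p \<in> topspace beta_omega"
    using p by (simp add: topspace_beta_omega_remainder)
  show ?thesis
  proof
    assume N: "N \<in> Nbhd p beta_omega_remainder"
    then obtain G where "openin beta_omega_remainder G" "p \<in> G" "G \<subseteq> N"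
      by (auto simp: Nbhd_def interior_of_def)
    then obtain H where H: "openin beta_omega H" "p \<in> H" "H \<inter> ?R \<subseteq> N"
      using R[of G] by auto
    obtain A where "A \<in> ultrafilter_of p" "clopen_of A \<subseteq> H"
      using clopen_of_base[OF H(1,2)] .
    then show "N \<subseteq> ?R \<and> (\<exists>A\<in>ultrafilter_of p. clopen_of A \<inter> ?R \<subseteq> N)"
      using N H(3) by (auto simp: Nbhd_def)
  next
    assume "N \<subseteq> ?R \<and> (\<exists>A\<in>ultrafilter_of p. clopen_of A \<inter> ?R \<subseteq> N)"
    then obtain A where A: "N \<subseteq> ?R" "A \<in> ultrafilter_of p" "clopen_of A \<inter> ?R \<subseteq> N"
      by blast
    then have "p \<in> clopen_of A \<inter> ?R"
      using p pt by (simp add: clopen_of_def)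
    moreover have "openin beta_omega_remainder (clopen_of A \<inter> ?R)"
      using R[of "clopen_of A \<inter> ?R"] openin_clopen_of by metis
    ultimately show "N \<in> Nbhd p beta_omega_remainder"
      using A(1,3) by (auto simp: Nbhd_def interior_of_def)
  qed
qed

text \<open>
  The clopen sets belonging to members of the ultrafilter of \<open>p\<close> form a neighborhood base at \<open>p\<close>. In
  the remainder such a clopen set determines the member only up to finite sets, so that there
  containment of neighborhoods becomes almost containment of members.
\<close>

lemma nbhd_filter_beta_omega_embedding:
  assumes p: "p \<in> topspace beta_omega" and P: "Preorder P"
    and e: "\<And>x. x \<in> Field P \<Longrightarrow> e x \<in> ultrafilter_of p"
    and ord: "\<And>x y. x \<in> Field P \<Longrightarrow> y \<in> Field P \<Longrightarrow> (x, y) \<in> P \<longleftrightarrow> e y \<subseteq> e x"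
    and cof: "\<And>A. A \<in> ultrafilter_of p \<Longrightarrow> \<exists>x\<in>Field P. e x \<subseteq> A"
  shows "cofinally_equivalent P (nbhd_filter p beta_omega)"
proof (rule cofinally_equivalent_embedding[OF P Preorder_nbhd_filter, where e = "\<lambda>x. clopen_of (e x)"])
  have N: "clopen_of (e x) \<in> Nbhd p beta_omega" if "x \<in> Field P" for x
    using e[OF that] by (auto simp: Nbhd_beta_omega[OF p] clopen_of_subset)
  then show "clopen_of (e x) \<in> Field (nbhd_filter p beta_omega)" if "x \<in> Field P" for x
    using that by (simp add: Field_nbhd_filter)
  show "(x, y) \<in> P \<longleftrightarrow> (clopen_of (e x), clopen_of (e y)) \<in> nbhd_filter p beta_omega"
    if "x \<in> Field P" "y \<in> Field P" for x y
    using that by (simp add: ord N nbhd_filter_def clopen_of_subset_iff)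
  show "\<exists>x\<in>Field P. (M, clopen_of (e x)) \<in> nbhd_filter p beta_omega"
    if M: "M \<in> Field (nbhd_filter p beta_omega)" for M
  proof -
    have MN: "M \<in> Nbhd p beta_omega"
      using M by (simp add: Field_nbhd_filter)
    then obtain A where A: "A \<in> ultrafilter_of p" "clopen_of A \<subseteq> M"
      using Nbhd_beta_omega[OF p] by blast
    obtain x where x: "x \<in> Field P" "e x \<subseteq> A"
      using cof[OF A(1)] by blast
    then have "clopen_of (e x) \<subseteq> M"
      using A(2) clopen_of_subset_iff by blast
    then show ?thesis
      using x(1) MN N unfolding nbhd_filter_def by blast
  qed
qed

lemma nbhd_filter_beta_omega_remainder_embedding:
  assumes p: "p \<in> topspace beta_omega_remainder" and P: "Preorder P"
    and e: "\<And>x. x \<in> Field P \<Longrightarrow> e x \<in> ultrafilter_of p"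
    and ord: "\<And>x y. x \<in> Field P \<Longrightarrow> y \<in> Field P \<Longrightarrow> (x, y) \<in> P \<longleftrightarrow> finite (e y - e x)"
    and cof: "\<And>A. A \<in> ultrafilter_of p \<Longrightarrow> \<exists>x\<in>Field P. e x \<subseteq> A"
  shows "cofinally_equivalent P (nbhd_filter p beta_omega_remainder)"
proof (rule cofinally_equivalent_embedding[OF P Preorder_nbhd_filter,
      where e = "\<lambda>x. clopen_of (e x) \<inter> topspace beta_omega_remainder"])
  let ?R = "topspace beta_omega_remainder"
  have N: "clopen_of (e x) \<inter> ?R \<in> Nbhd p beta_omega_remainder" if "x \<in> Field P" for x
    using e[OF that] by (auto simp: Nbhd_beta_omega_remainder[OF p])
  then show "clopen_of (e x) \<inter> ?R \<in> Field (nbhd_filter p beta_omega_remainder)" if "x \<in> Field P" for x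
    using that by (simp add: Field_nbhd_filter)
  show "(x, y) \<in> P \<longleftrightarrow> (clopen_of (e x) \<inter> ?R, clopen_of (e y) \<inter> ?R) \<in> nbhd_filter p beta_omega_remainder"
    if "x \<in> Field P" "y \<in> Field P" for x y
    unfolding nbhd_filter_def using that clopen_of_remainder_subset_iff[of "e y" "e x"]
    by (simp add: ord N)
  show "\<exists>x\<in>Field P. (M, clopen_of (e x) \<inter> ?R) \<in> nbhd_filter p beta_omega_remainder"
    if M: "M \<in> Field (nbhd_filter p beta_omega_remainder)" for M
  proof -
    have MN: "M \<in> Nbhd p beta_omega_remainder"
      using M by (simp add: Field_nbhd_filter)
    then obtain A where A: "A \<in> ultrafilter_of p" "clopen_of A \<inter> ?R \<subseteq> M"
      using Nbhd_beta_omega_remainder[OF p] by blast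
    obtain x where x: "x \<in> Field P" "e x \<subseteq> A"
      using cof[OF A(1)] by blast
    then have "clopen_of (e x) \<inter> ?R \<subseteq> M"
      using A(2) clopen_of_subset_iff by blast
    then show ?thesis
      using x(1) MN N unfolding nbhd_filter_def by blast
  qed
qed

lemma nbhd_filter_beta_omega_equivalent:
  assumes "p \<in> topspace beta_omega"
  shows "cofinally_equivalent (superset_order (ultrafilter_of p)) (nbhd_filter p beta_omega)"
  by (rule nbhd_filter_beta_omega_embedding[OF assms Preorder_superset_order, where e = "\<lambda>A. A"],
      unfold Field_superset_order) (auto simp: superset_order_def)

lemma nbhd_filter_beta_omega_remainder_equivalent:
  assumes "p \<in> topspace beta_omega_remainder"
  shows "cofinally_equivalent (almost_superset_order (ultrafilter_of p)) (nbhd_filter p beta_omega_remainder)"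
  by (rule nbhd_filter_beta_omega_remainder_embedding[OF assms Preorder_almost_superset_order, where e = "\<lambda>A. A"],
      unfold Field_almost_superset_order) (auto simp: almost_superset_order_def)

section \<open>Cofinally scalene neighborhood filters\<close>

lemma cofinally_scalene_sigma_bounded:
  fixes P :: "'a rel"
  assumes "cofinally_scalene P"
  shows "sigma_bounded P"
proof -
  obtain S :: "'a rel set" where S: "set_of_regular_cardinals S" "cofinally_equivalent P (prod_order S)"
    using assms unfolding cofinally_scalene_def by blast
  obtain t s where "tukey_connection P (prod_order S) t s"
    using S(2) by (rule cofinally_equivalent_tukey)
  then show ?thesis
    using sigma_bounded_prod_order[OF S(1)] by (rule sigma_bounded_tukey)
qed

lemma sigma_bounded_cofinally_equivalent:
  assumes "cofinally_equivalent P Q" "sigma_bounded Q"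
  shows "sigma_bounded P"
  using cofinally_equivalent_tukey[OF assms(1)] sigma_bounded_tukey[OF _ assms(2)] by metis

theorem cofinally_scalene_nbhd_filter_beta_omega:
  assumes p: "p \<in> topspace beta_omega" and sc: "cofinally_scalene (nbhd_filter p beta_omega)"
  shows "cofinally_equivalent (nbhd_filter p beta_omega) BNF_Cardinal_Arithmetic.cone"
proof -
  have u: "nat_ultrafilter (ultrafilter_of p)"
    using p by (rule nat_ultrafilter_ultrafilter_of)
  have "sigma_bounded (superset_order (ultrafilter_of p))"
    using nbhd_filter_beta_omega_equivalent[OF p] cofinally_scalene_sigma_bounded[OF sc]
    by (rule sigma_bounded_cofinally_equivalent)
  then have "\<not> free_ultrafilter (ultrafilter_of p)"
    using superset_order_not_sigma_bounded by metis
  then obtain n where n: "{n} \<in> ultrafilter_of p"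
    using u unfolding free_ultrafilter_def by blast
  have Fc: "Field BNF_Cardinal_Arithmetic.cone = {()}"
    by (simp add: BNF_Cardinal_Arithmetic.cone_def Field_card_of)
  have pre: "Preorder BNF_Cardinal_Arithmetic.cone"
    by (rule Card_order_Preorder) (simp add: BNF_Cardinal_Arithmetic.cone_def card_of_Card_order)
  have "cofinally_equivalent BNF_Cardinal_Arithmetic.cone (nbhd_filter p beta_omega)"
  proof (rule nbhd_filter_beta_omega_embedding[OF p pre, where e = "\<lambda>_. {n}"])
    show "(x, y) \<in> BNF_Cardinal_Arithmetic.cone \<longleftrightarrow> {n} \<subseteq> {n}" for x y
      using Preorder_refl[OF pre, of "()"] by (simp add: Fc)
    show "\<exists>x\<in>Field BNF_Cardinal_Arithmetic.cone. {n} \<subseteq> A" if "A \<in> ultrafilter_of p" for A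
    proof -
      have "{n} \<inter> A \<in> ultrafilter_of p"
        using n that nat_ultrafilter_Int[OF u] by blast
      then have "{n} \<inter> A \<noteq> {}"
        using nat_ultrafilter_empty[OF u] by metis
      then show ?thesis by (simp add: Fc)
    qed
  qed (use n in simp)
  then show ?thesis
    by (rule cofinally_equivalent_sym)
qed

lemma continuum_ordIso: "continuum =o |UNIV :: nat set set|"
proof -
  have "bij_betw (\<lambda>f :: nat \<Rightarrow> bool. Collect f) UNIV (UNIV :: nat set set)"
    by (intro bij_betwI[where g = "\<lambda>A n. n \<in> A"]) auto
  then have "|UNIV :: (nat \<Rightarrow> bool) set| =o |UNIV :: nat set set|"
    by (rule card_of_ordIsoI)
  then show ?thesis
    by (simp add: continuum_def cexp_def ctwo_def Field_natLeq Field_card_of Func_def)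
qed

lemma Card_order_continuum: "Card_order continuum"
  unfolding continuum_def by (rule Card_order_cexp)

lemma Card_order_ordIso_cofinally_equivalent:
  fixes \<mu> :: "'a rel" and \<nu> :: "'b rel"
  assumes "Card_order \<mu>" "Card_order \<nu>" "\<mu> =o \<nu>"
  shows "cofinally_equivalent \<mu> \<nu>"
proof -
  obtain f where f: "iso \<mu> \<nu> f"
    using assms(3) unfolding ordIso_def by blast
  show ?thesis
  proof (rule cofinally_equivalent_embedding[where e = f])
    show "Preorder \<mu>" and \<nu>: "Preorder \<nu>"
      using assms(1,2) by (simp_all add: Card_order_Preorder)
    show "\<exists>x\<in>Field \<mu>. (y, f x) \<in> \<nu>" if "y \<in> Field \<nu>" for y
    proof -
      have "y \<in> f ` Field \<mu>"
        using f that by (simp add: iso_iff2 bij_betw_def)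
      then show ?thesis
        using Preorder_refl[OF \<nu> that] by auto
    qed
    show "f x \<in> Field \<nu>" if "x \<in> Field \<mu>" for x
      using f that by (auto simp: iso_iff2 bij_betw_def)
    show "(x, y) \<in> \<mu> \<longleftrightarrow> (f x, f y) \<in> \<nu>" if "x \<in> Field \<mu>" "y \<in> Field \<mu>" for x y
      using f that by (simp add: iso_iff2)
  qed
qed

lemma prod_order_one_factor:
  fixes S :: "'a rel set"
  assumes C: "\<And>\<nu>. \<nu> \<in> S \<Longrightarrow> Card_order \<nu>" and \<mu>: "\<mu> \<in> S"
    and one: "\<And>\<nu>. \<nu> \<in> S \<Longrightarrow> \<nu> \<noteq> \<mu> \<Longrightarrow> \<nu> =o cone"
  shows "cofinally_equivalent \<mu> (prod_order S)"
proof -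
  have pre: "\<And>\<nu>. \<nu> \<in> S \<Longrightarrow> Preorder \<nu>"
    using C by (rule Card_order_Preorder)
  have FS: "Field (prod_order S) = Pi\<^sub>E S Field"
    using pre by (rule Field_prod_order)
  have "\<forall>\<nu>. \<exists>z. \<nu> \<in> S \<longrightarrow> \<nu> \<noteq> \<mu> \<longrightarrow> Field \<nu> = {z}"
    using cone_Field[OF C one] by metis
  then obtain z where z: "\<And>\<nu>. \<nu> \<in> S \<Longrightarrow> \<nu> \<noteq> \<mu> \<Longrightarrow> Field \<nu> = {z \<nu>}"
    by metis
  define e where "e x = (\<lambda>\<nu>\<in>S. if \<nu> = \<mu> then x else z \<nu>)" for x
  have e: "e x \<in> Pi\<^sub>E S Field" if "x \<in> Field \<mu>" for x
    using that z by (auto simp: e_def)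
  have re: "(z \<nu>, z \<nu>) \<in> \<nu>" if "\<nu> \<in> S" "\<nu> \<noteq> \<mu>" for \<nu>
    using Preorder_refl[OF pre[OF that(1)], of "z \<nu>"] z[OF that] by simp
  show ?thesis
  proof (rule cofinally_equivalent_embedding[where e = e])
    show "Preorder \<mu>" "Preorder (prod_order S)"
      using pre \<mu> by (simp_all add: Preorder_prod_order)
    show "e x \<in> Field (prod_order S)" if "x \<in> Field \<mu>" for x
      using e[OF that] by (simp add: FS)
    show "(x, y) \<in> \<mu> \<longleftrightarrow> (e x, e y) \<in> prod_order S" if "x \<in> Field \<mu>" "y \<in> Field \<mu>" for x y
      using that e \<mu> re by (auto simp: prod_order_def e_def)
    show "\<exists>x\<in>Field \<mu>. (f, e x) \<in> prod_order S" if "f \<in> Field (prod_order S)" for f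
    proof (intro bexI)
      have f: "f \<in> Pi\<^sub>E S Field"
        using that by (simp add: FS)
      then show f\<mu>: "f \<mu> \<in> Field \<mu>"
        using \<mu> by (rule PiE_mem)
      have "f \<nu> = z \<nu>" if "\<nu> \<in> S" "\<nu> \<noteq> \<mu>" for \<nu>
        using PiE_mem[OF f that(1)] z[OF that] by simp
      moreover have "(f \<mu>, f \<mu>) \<in> \<mu>"
        using Preorder_refl[OF pre[OF \<mu>] f\<mu>] .
      ultimately show "(f, e (f \<mu>)) \<in> prod_order S"
        using f e[OF f\<mu>] re by (auto simp: prod_order_def e_def)
    qed
  qed
qed

lemma countably_bounded_prod_order_factor:
  assumes S: "set_of_regular_cardinals S" and \<mu>: "\<mu> \<in> S" "infinite (Field \<mu>)"
    and cb: "countably_bounded (Field (prod_order S)) (prod_order S)"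
  shows "uncountable (Field \<mu>)"
proof
  assume cnt: "countable (Field \<mu>)"
  have reg: "\<And>\<nu>. \<nu> \<in> S \<Longrightarrow> regular_cardinal \<nu>"
    using S by (simp add: set_of_regular_cardinals_def)
  have C: "\<And>\<nu>. \<nu> \<in> S \<Longrightarrow> Card_order \<nu>"
    using reg by (rule regular_cardinal_Card_order)
  have FS: "Field (prod_order S) = Pi\<^sub>E S Field"
    using C by (intro Field_prod_order Card_order_Preorder)
  have "\<forall>\<nu>. \<exists>x. \<nu> \<in> S \<longrightarrow> x \<in> Field \<nu>"
    using regular_cardinal_nonempty[OF reg] by blast
  then obtain b where b: "\<And>\<nu>. \<nu> \<in> S \<Longrightarrow> b \<nu> \<in> Field \<nu>"
    by metis
  define h where "h x = (\<lambda>\<nu>\<in>S. if \<nu> = \<mu> then x else b \<nu>)" for x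
  have "h ` Field \<mu> \<subseteq> Pi\<^sub>E S Field"
    using b by (auto simp: h_def)
  moreover have "countable (h ` Field \<mu>)"
    using cnt by simp
  ultimately obtain f where f: "f \<in> Pi\<^sub>E S Field" "\<forall>g\<in>h ` Field \<mu>. (g, f) \<in> prod_order S"
    using cb unfolding countably_bounded_def FS by meson
  have top: "(x, f \<mu>) \<in> \<mu>" if "x \<in> Field \<mu>" for x
  proof -
    have "(h x, f) \<in> prod_order S"
      using f(2) that by blast
    then have "(h x \<mu>, f \<mu>) \<in> \<mu>"
      using \<mu>(1) by (simp add: prod_order_def)
    then show ?thesis
      using \<mu>(1) by (simp add: h_def)
  qed
  have f\<mu>: "f \<mu> \<in> Field \<mu>"
    using f(1) \<mu>(1) by (rule PiE_mem)
  then obtain y where y: "y \<in> Field \<mu>" "f \<mu> \<noteq> y" "(f \<mu>, y) \<in> \<mu>"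
    using infinite_Card_order_limit[OF C[OF \<mu>(1)] \<mu>(2)] by blast
  have "antisym \<mu>"
    using C[OF \<mu>(1)] by (auto simp: card_order_on_def well_order_on_def linear_order_on_def partial_order_on_def)
  then show False
    using y top[OF y(1)] by (blast dest: antisymD)
qed

lemma CH_continuum_least_uncountable:
  fixes \<mu> :: "'a rel"
  assumes ch: CH and C: "Card_order \<mu>" and unc: "uncountable (Field \<mu>)"
    and le: "|Field \<mu>| \<le>o |UNIV :: nat set set|"
  shows "\<mu> =o continuum"
proof -
  have "\<not> |Field \<mu>| \<le>o natLeq"
  proof
    assume "|Field \<mu>| \<le>o natLeq"
    then have "|Field \<mu>| \<le>o |UNIV :: nat set|"
      using ordIso_symmetric[OF card_of_nat] by (rule ordLeq_ordIso_trans)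
    then show False
      using unc by (auto simp: card_of_ordLeq[symmetric] countable_def)
  qed
  then have "natLeq <o |Field \<mu>|"
    using not_ordLeq_iff_ordLess[OF natLeq_Well_order card_of_Well_order] by blast
  then have "natLeq <o \<mu>"
    using card_of_Field_ordIso[OF C] by (rule ordLess_ordIso_trans)
  then have "cardSuc natLeq \<le>o \<mu>"
    using cardSuc_ordLess_ordLeq[OF natLeq_Card_order C] by blast
  with ch have "continuum \<le>o \<mu>"
    unfolding CH_def by (rule ordIso_ordLeq_trans)
  moreover have "\<mu> \<le>o continuum"
    using ordIso_ordLeq_trans[OF ordIso_symmetric[OF card_of_Field_ordIso[OF C]]
        ordLeq_ordIso_trans[OF le ordIso_symmetric[OF continuum_ordIso]]] .
  ultimately show ?thesis
    by (simp add: ordIso_iff_ordLeq)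
qed

text \<open>
  Being a countable union of countably bounded sets forces the ultrafilter to be a P-point. So the
  product is countably directed and has no factor \<open>\<omega>\<close>. It has no greatest element, since a free
  ultrafilter has no countable base; so it has an infinite factor. As the ultrafilter consists of
  subsets of \<open>\<omega>\<close>, no factor exceeds \<open>\<cc>\<close>, and CH leaves \<open>\<cc>\<close> as the only infinite factor.
\<close>

theorem cofinally_scalene_nbhd_filter_beta_omega_remainder:
  assumes ch: CH and p: "p \<in> topspace beta_omega_remainder"
    and sc: "cofinally_scalene (nbhd_filter p beta_omega_remainder)"
  shows "cofinally_equivalent (nbhd_filter p beta_omega_remainder) continuum"
proof -
  define U where "U = ultrafilter_of p"
  let ?N = "nbhd_filter p beta_omega_remainder"
  have U: "free_ultrafilter U"
    using p by (simp add: topspace_beta_omega_remainder U_def)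
  have eq: "cofinally_equivalent (almost_superset_order U) ?N"
    unfolding U_def using p by (rule nbhd_filter_beta_omega_remainder_equivalent)
  obtain S :: "((nat \<Rightarrow> real) \<Rightarrow> real) set rel set"
    where S: "set_of_regular_cardinals S" and NS: "cofinally_equivalent ?N (prod_order S)"
    using sc unfolding cofinally_scalene_def by blast
  have US: "cofinally_equivalent (almost_superset_order U) (prod_order S)"
    using eq NS by (rule cofinally_equivalent_trans)
  have reg: "\<And>\<nu>. \<nu> \<in> S \<Longrightarrow> regular_cardinal \<nu>"
    using S by (simp add: set_of_regular_cardinals_def)
  have C: "\<And>\<nu>. \<nu> \<in> S \<Longrightarrow> Card_order \<nu>"
    using reg by (rule regular_cardinal_Card_order)
  have FS: "Field (prod_order S) = Pi\<^sub>E S Field"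
    using C by (intro Field_prod_order Card_order_Preorder)
  have "sigma_bounded (almost_superset_order U)"
    using eq cofinally_scalene_sigma_bounded[OF sc] by (rule sigma_bounded_cofinally_equivalent)
  then have cbU: "countably_bounded U (almost_superset_order U)"
    by (rule sigma_bounded_almost_superset_order_P_point[OF U])
  obtain t s where "tukey_connection (prod_order S) (almost_superset_order U) t s"
    using cofinally_equivalent_sym[OF US] by (rule cofinally_equivalent_tukey)
  then have "countably_bounded {f \<in> Field (prod_order S). t f \<in> U} (prod_order S)"
    and tU: "\<And>f. f \<in> Field (prod_order S) \<Longrightarrow> t f \<in> U"
    using countably_bounded_tukey[OF _ cbU]
    by (auto simp: tukey_connection_def Field_almost_superset_order)
  moreover have "{f \<in> Field (prod_order S). t f \<in> U} = Field (prod_order S)"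
    using tU by blast
  ultimately have cbS: "countably_bounded (Field (prod_order S)) (prod_order S)"
    by simp
  have cont: "\<nu> =o continuum" if \<nu>: "\<nu> \<in> S" "infinite (Field \<nu>)"
    for \<nu> :: "((nat \<Rightarrow> real) \<Rightarrow> real) set rel"
    using ch C[OF \<nu>(1)] countably_bounded_prod_order_factor[OF S \<nu> cbS]
      cofinally_equivalent_prod_order_bound[OF S US \<nu>(1)]
    by (rule CH_continuum_least_uncountable)
  have "\<exists>\<mu>\<in>S. infinite (Field \<mu>)"
  proof (rule ccontr)
    assume fin: "\<not> (\<exists>\<mu>\<in>S. infinite (Field \<mu>))"
    have one: "\<exists>z. Field \<nu> = {z}" if \<nu>: "\<nu> \<in> S" for \<nu>
    proof -
      have "\<nu> =o cone"
        using fin reg[OF \<nu>] \<nu> by (auto simp: regular_cardinal_def)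
      then show ?thesis
        by (rule cone_Field[OF C[OF \<nu>]]) blast
    qed
    then have "\<forall>\<nu>. \<exists>z. \<nu> \<in> S \<longrightarrow> Field \<nu> = {z}"
      by blast
    then obtain z where z: "\<And>\<nu>. \<nu> \<in> S \<Longrightarrow> Field \<nu> = {z \<nu>}"
      by metis
    have top: "(f, restrict z S) \<in> prod_order S" if f: "f \<in> Pi\<^sub>E S Field" for f
    proof -
      have "(f \<nu>, z \<nu>) \<in> \<nu>" if \<nu>: "\<nu> \<in> S" for \<nu>
        using PiE_mem[OF f \<nu>] Preorder_refl[OF Card_order_Preorder[OF C[OF \<nu>]]] z[OF \<nu>] by auto
      then show ?thesis
        using f z by (auto simp: prod_order_def)
    qed
    obtain t s where ts: "tukey_connection (almost_superset_order U) (prod_order S) t s"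
      using US by (rule cofinally_equivalent_tukey)
    define B where "B = s (restrict z S)"
    have zS: "restrict z S \<in> Pi\<^sub>E S Field"
      using z by simp
    have t: "t \<in> U \<rightarrow> Pi\<^sub>E S Field" and s: "s \<in> Pi\<^sub>E S Field \<rightarrow> U"
      and st: "\<And>A f. A \<in> U \<Longrightarrow> f \<in> Pi\<^sub>E S Field \<Longrightarrow> (t A, f) \<in> prod_order S \<Longrightarrow>
        (A, s f) \<in> almost_superset_order U"
      using ts unfolding tukey_connection_def FS Field_almost_superset_order by simp_all
    have B: "B \<in> U"
      unfolding B_def using s zS by (rule funcset_mem)
    have fin: "finite (B - A)" if "A \<in> U" for A
      using st[OF that zS top[OF funcset_mem[OF t that]]]
      unfolding B_def by (simp add: almost_superset_order_def)
    have "B - {..<n} \<in> U" for n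
      using U B by (rule free_ultrafilter_Diff_finite) simp
    then obtain A where A: "A \<in> U" "\<And>n. \<not> B - {..<n} \<subseteq> A"
      using free_ultrafilter_no_countable_base[OF U, where D = "\<lambda>n. B - {..<n}"] by blast
    obtain n where "B - A \<subseteq> {..<n}"
      using fin[OF A(1)] unfolding finite_nat_iff_bounded ..
    then show False
      using A(2)[of n] by blast
  qed
  then obtain \<mu> where \<mu>: "\<mu> \<in> S" "infinite (Field \<mu>)" by blast
  have one: "\<nu> =o cone" if \<nu>: "\<nu> \<in> S" "\<nu> \<noteq> \<mu>"
    for \<nu> :: "((nat \<Rightarrow> real) \<Rightarrow> real) set rel"
  proof (rule ccontr)
    assume "\<not> \<nu> =o cone"
    then have "infinite (Field \<nu>)"
      using reg[OF \<nu>(1)] by (simp add: regular_cardinal_def)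
    then have "\<nu> =o \<mu>"
      using cont[OF \<nu>(1)] ordIso_symmetric[OF cont[OF \<mu>]] ordIso_transitive by metis
    then show False
      using S \<nu> \<mu>(1) by (simp add: set_of_regular_cardinals_def)
  qed
  have "cofinally_equivalent \<mu> (prod_order S)"
    by (rule prod_order_one_factor[OF C \<mu>(1) one])
  then have "cofinally_equivalent ?N \<mu>"
    by (rule cofinally_equivalent_trans[OF NS cofinally_equivalent_sym])
  then show ?thesis
    using Card_order_ordIso_cofinally_equivalent[OF C[OF \<mu>(1)] Card_order_continuum cont[OF \<mu>]]
    by (rule cofinally_equivalent_trans)
qed

section \<open>Ramsey ultrafilters\<close>

definition homogeneous :: "(nat \<Rightarrow> nat \<Rightarrow> bool) \<Rightarrow> nat set \<Rightarrow> bool" where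
  "homogeneous R H \<longleftrightarrow> (\<exists>b. \<forall>m\<in>H. \<forall>n\<in>H. m < n \<longrightarrow> R m n = b)"

definition ramsey_ultrafilter :: "nat set set \<Rightarrow> bool" where
  "ramsey_ultrafilter U \<longleftrightarrow> free_ultrafilter U \<and> (\<forall>R. \<exists>H\<in>U. homogeneous R H)"

lemma homogeneous_subset:
  assumes "homogeneous R H" "K \<subseteq> H"
  shows "homogeneous R K"
proof -
  obtain b where "\<forall>m\<in>H. \<forall>n\<in>H. m < n \<longrightarrow> R m n = b"
    using assms(1) unfolding homogeneous_def ..
  then show ?thesis
    unfolding homogeneous_def using assms(2) by (intro exI[of _ b]) auto
qed

lemma ex_homogeneous_subset:
  assumes "infinite P"
  shows "\<exists>H\<subseteq>P. infinite H \<and> homogeneous R H"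
proof -
  define f where "f X = (if R (Min X) (Max X) then 0 else 1 :: nat)" for X
  have "\<forall>x\<in>P. \<forall>y\<in>P. x \<noteq> y \<longrightarrow> f {x, y} < 2"
    by (simp add: f_def)
  from Ramsey2[OF assms this] obtain H t where H: "H \<subseteq> P" "infinite H"
    "\<forall>x\<in>H. \<forall>y\<in>H. x \<noteq> y \<longrightarrow> f {x, y} = t"
    by (elim exE conjE)
  have "R m n = (t = 0)" if "m \<in> H" "n \<in> H" "m < n" for m n
    using bspec[OF bspec[OF H(3) that(1)] that(2)] that(3) by (auto simp: f_def split: if_splits)
  then have "homogeneous R H"
    unfolding homogeneous_def by (intro exI[of _ "t = 0"]) simp
  then show ?thesis
    using H(1,2) by blast
qed

text \<open>The homogeneous set for \<open>m \<in> X n\<close> cannot avoid the sets \<open>X n\<close>, which lie in the ultrafilter.\<close>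

lemma ramsey_ultrafilter_diagonal:
  assumes U: "ramsey_ultrafilter U" and X: "\<And>n. X n \<in> U"
  obtains B where "B \<in> U" "\<And>n m. n \<in> B \<Longrightarrow> m \<in> B \<Longrightarrow> n < m \<Longrightarrow> m \<in> X n"
proof -
  have f: "free_ultrafilter U" and u: "nat_ultrafilter U"
    using U by (auto simp: ramsey_ultrafilter_def free_ultrafilter_def)
  have "\<exists>H\<in>U. homogeneous (\<lambda>n m. m \<in> X n) H"
    using U by (simp add: ramsey_ultrafilter_def)
  then obtain B b where B: "B \<in> U" "\<And>n m. n \<in> B \<Longrightarrow> m \<in> B \<Longrightarrow> n < m \<Longrightarrow> (m \<in> X n) = b"
    unfolding homogeneous_def by meson
  obtain n where n: "n \<in> B"
    using free_ultrafilter_infinite[OF f B(1)] by (metis ex_in_conv finite.emptyI)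
  have "B \<inter> X n \<in> U"
    using B(1) X nat_ultrafilter_Int[OF u] by simp
  then have "infinite (B \<inter> X n)"
    using free_ultrafilter_infinite[OF f] by simp
  then obtain m where "n < m" "m \<in> B \<inter> X n"
    by (meson infinite_nat_iff_unbounded)
  then have b
    using B(2)[OF n, of m] by simp
  then show thesis
    using B by (intro that[of B]) auto
qed

section \<open>Few ultrafilters below a Ramsey ultrafilter\<close>

text \<open>
  The finite parts of \<open>Y\<close> that end in a point of \<open>Y\<close> decide the value at \<open>Y\<close>; \<open>\<Gamma>\<close> is the coded list
  of these decisions. So a map of this form is given by a single subset of \<open>nat\<close>. The restriction
  \<open>k \<le> n\<close> leaves only finitely many questions to be decided by each finite part.
\<close>

definition approximated_map :: "nat set \<Rightarrow> nat set \<Rightarrow> nat set" where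
  "approximated_map \<Gamma> Y =
     {k. \<forall>n\<in>Y. k \<le> n \<longrightarrow> prod_encode (set_encode (Y \<inter> {..n}), k) \<in> \<Gamma>}"

text \<open>
  \<open>\<Gamma>\<close> records which \<open>k\<close> are forced into \<open>g (s \<union> Z)\<close>, for all \<open>Z \<in> U\<close>, by the finite set \<open>s\<close>. If \<open>k\<close> is
  not forced by \<open>s\<close>, this has a witness \<open>Z\<close>. Diagonalizing over all witnesses gives \<open>B \<in> U\<close> such that the
  tail of each \<open>Y \<subseteq> B\<close> beyond \<open>n \<in> Y\<close> is included in all witnesses that belong to numbers up to
  \<open>n\<close>; then \<open>Y \<inter> {..n}\<close> decides whether \<open>k \<in> g Y\<close>.
\<close>

lemma ramsey_ultrafilter_continuous_mono:
  assumes U: "ramsey_ultrafilter U" and g: "mono g"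
  obtains B \<Gamma> where "B \<in> U" "\<And>Y. Y \<in> U \<Longrightarrow> Y \<subseteq> B \<Longrightarrow> g Y = approximated_map \<Gamma> Y"
proof -
  have f: "free_ultrafilter U" and u: "nat_ultrafilter U"
    using U by (auto simp: ramsey_ultrafilter_def free_ultrafilter_def)
  define \<Gamma> where "\<Gamma> = {i. \<forall>Z\<in>U. snd (prod_decode i) \<in> g (set_decode (fst (prod_decode i)) \<union> Z)}"
  have \<Gamma>: "prod_encode (e, k) \<in> \<Gamma> \<longleftrightarrow> (\<forall>Z\<in>U. k \<in> g (set_decode e \<union> Z))" for e k
    by (simp add: \<Gamma>_def)
  have "\<forall>e k. \<exists>Z\<in>U. prod_encode (e, k) \<notin> \<Gamma> \<longrightarrow> k \<notin> g (set_decode e \<union> Z)"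
    unfolding \<Gamma> using nat_ultrafilter_UNIV[OF u] by blast
  then obtain Z where ZU: "\<And>e k. Z e k \<in> U"
    and Z: "\<And>e k. prod_encode (e, k) \<notin> \<Gamma> \<Longrightarrow> k \<notin> g (set_decode e \<union> Z e k)"
    by metis
  define X where "X n = (\<Inter>(s, k)\<in>Pow {..n} \<times> {..n}. Z (set_encode s) k)" for n
  have "X n \<in> U" for n
    unfolding X_def using ZU by (intro nat_ultrafilter_INT[OF u]) auto
  then obtain B where B: "B \<in> U" "\<And>n m. n \<in> B \<Longrightarrow> m \<in> B \<Longrightarrow> n < m \<Longrightarrow> m \<in> X n"
    using ramsey_ultrafilter_diagonal[OF U] by blast
  have "g Y = approximated_map \<Gamma> Y" if Y: "Y \<in> U" "Y \<subseteq> B" for Y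
  proof -
    have dec: "k \<in> g Y \<longleftrightarrow> prod_encode (set_encode (Y \<inter> {..n}), k) \<in> \<Gamma>" if n: "n \<in> Y" "k \<le> n" for n k
    proof
      assume k: "k \<in> g Y"
      show "prod_encode (set_encode (Y \<inter> {..n}), k) \<in> \<Gamma>"
      proof (rule ccontr)
        let ?s = "Y \<inter> {..n}"
        assume "prod_encode (set_encode ?s, k) \<notin> \<Gamma>"
        from Z[OF this] have "k \<notin> g (?s \<union> Z (set_encode ?s) k)"
          by simp
        moreover have sub: "X n \<subseteq> Z (set_encode ?s) k"
          using n(2) unfolding X_def by (intro INF_lower2[where i = "(?s, k)"]) auto
        have "Y \<subseteq> ?s \<union> Z (set_encode ?s) k"
        proof
          fix m assume m: "m \<in> Y"
          show "m \<in> ?s \<union> Z (set_encode ?s) k"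
          proof (cases "m \<le> n")
            case False
            then have "m \<in> X n"
              using m n(1) Y(2) by (intro B(2)) auto
            then show ?thesis
              using sub by blast
          qed (use m in simp)
        qed
        then have "g Y \<subseteq> g (?s \<union> Z (set_encode ?s) k)"
          by (rule monoD[OF g])
        ultimately show False
          using k by blast
      qed
    next
      assume "prod_encode (set_encode (Y \<inter> {..n}), k) \<in> \<Gamma>"
      then have "\<forall>Z\<in>U. k \<in> g (Y \<inter> {..n} \<union> Z)"
        unfolding \<Gamma> by simp
      from bspec[OF this Y(1)] have "k \<in> g (Y \<inter> {..n} \<union> Y)" .
      moreover have "Y \<inter> {..n} \<union> Y = Y"
        by blast
      ultimately show "k \<in> g Y"
        by simp
    qed
    have ex: "\<exists>n\<in>Y. k \<le> n" for k
      using free_ultrafilter_infinite[OF f Y(1)] by (meson infinite_nat_iff_unbounded_le)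
    show ?thesis
    proof (intro set_eqI iffI)
      fix k
      show "k \<in> approximated_map \<Gamma> Y" if "k \<in> g Y"
        unfolding approximated_map_def using iffD1[OF dec] that by blast
      show "k \<in> g Y" if k: "k \<in> approximated_map \<Gamma> Y"
      proof -
        obtain n where n: "n \<in> Y" "k \<le> n"
          using ex by blast
        then show ?thesis
          using iffD2[OF dec[OF n]] k unfolding approximated_map_def by blast
      qed
    qed
  qed
  then show thesis
    using B(1) that by blast
qed

definition decoded_filter :: "nat set set \<Rightarrow> nat set \<times> nat set \<Rightarrow> nat set set" where
  "decoded_filter U c = {A. \<exists>Y\<in>U. Y \<subseteq> fst c \<and> approximated_map (snd c) Y \<subseteq> A}"

text \<open>
  A Tukey map \<open>t\<close> from \<open>V\<close> to \<open>U\<close> turns into a monotone map \<open>g\<close> from \<open>U\<close> onto a base of \<open>V\<close>, by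
  intersecting all \<open>A\<close> with \<open>B \<subseteq> t A\<close>; the intersection is not too small since these \<open>A\<close> have a
  common bound in \<open>V\<close>. Below some \<open>B \<in> U\<close> the map \<open>g\<close> is coded by one set, so that \<open>U\<close> and two subsets of
  \<open>nat\<close> determine \<open>V\<close>.
\<close>

lemma ultrafilter_below_ramsey_decoded:
  assumes U: "ramsey_ultrafilter U" and v: "nat_ultrafilter V"
    and eq: "cofinally_equivalent (superset_order V) (superset_order U)"
  shows "V \<in> range (decoded_filter U)"
proof -
  have u: "nat_ultrafilter U"
    using U by (auto simp: ramsey_ultrafilter_def free_ultrafilter_def)
  obtain t s where ts: "tukey_connection (superset_order V) (superset_order U) t s"
    using eq by (rule cofinally_equivalent_tukey)
  have t: "t A \<in> U" if "A \<in> V" for A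
    using ts that by (auto simp: tukey_connection_def Field_superset_order)
  have s: "s B \<in> V" if "B \<in> U" for B
    using ts that by (auto simp: tukey_connection_def Field_superset_order)
  have ts': "s B \<subseteq> A" if "A \<in> V" "B \<in> U" "B \<subseteq> t A" for A B
    using ts that t[OF that(1)] unfolding tukey_connection_def Field_superset_order
    by (simp add: superset_order_def)
  define g where "g B = \<Inter>{A \<in> V. B \<subseteq> t A}" for B
  have g: "mono g"
    by (intro monoI) (auto simp: g_def)
  have gV: "g B \<in> V" if "B \<in> U" for B
  proof (rule nat_ultrafilter_mono[OF v s[OF that]])
    show "s B \<subseteq> g B"
      using ts'[OF _ that] by (auto simp: g_def)
  qed
  have gt: "g (t A) \<subseteq> A" if "A \<in> V" for A
    using that by (auto simp: g_def)
  obtain B \<Gamma> where B: "B \<in> U" "\<And>Y. Y \<in> U \<Longrightarrow> Y \<subseteq> B \<Longrightarrow> g Y = approximated_map \<Gamma> Y"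
    using ramsey_ultrafilter_continuous_mono[OF U g] by blast
  have "V = decoded_filter U (B, \<Gamma>)"
  proof (rule set_eqI)
    fix A
    show "A \<in> V \<longleftrightarrow> A \<in> decoded_filter U (B, \<Gamma>)"
    proof
      assume A: "A \<in> V"
      have "t A \<inter> B \<in> U"
        using t[OF A] B(1) nat_ultrafilter_Int[OF u] by simp
      moreover have "g (t A \<inter> B) \<subseteq> A"
        using monoD[OF g, of "t A \<inter> B" "t A"] gt[OF A] by auto
      ultimately show "A \<in> decoded_filter U (B, \<Gamma>)"
        using B(2)[of "t A \<inter> B"] unfolding decoded_filter_def by auto
    next
      assume "A \<in> decoded_filter U (B, \<Gamma>)"
      then obtain Y where Y: "Y \<in> U" "Y \<subseteq> B" "approximated_map \<Gamma> Y \<subseteq> A"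
        unfolding decoded_filter_def by auto
      then have "g Y \<subseteq> A"
        using B(2) by simp
      then show "A \<in> V"
        by (rule nat_ultrafilter_mono[OF v gV[OF Y(1)]])
    qed
  qed
  then show ?thesis by blast
qed

section \<open>Two to the continuum Ramsey ultrafilters\<close>

lemma infinite_split:
  fixes H :: "nat set"
  assumes "infinite H"
  shows "\<exists>K\<subseteq>H. infinite K \<and> infinite (H - K)"
proof -
  obtain x :: "nat \<Rightarrow> nat" where x: "strict_mono x" "\<And>n. x n \<in> H"
    using infinite_enumerate[OF assms] by metis
  define K where "K = range (\<lambda>n. x (2 * n))"
  have "x (2 * n + 1) \<in> H - K" for n
    using x(2)[of "2 * n + 1"] strict_mono_eq[OF x(1)] by (auto simp: K_def) presburger
  then have "range (\<lambda>n. x (2 * n + 1)) \<subseteq> H - K"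
    by blast
  moreover have "inj (\<lambda>n. x (2 * n + 1))" "inj (\<lambda>n. x (2 * n))"
    by (simp_all add: inj_def strict_mono_eq[OF x(1)])
  ultimately have "infinite (H - K)" "infinite K"
    unfolding K_def using range_inj_infinite finite_subset by metis+
  moreover have "K \<subseteq> H"
    using x(2) by (auto simp: K_def)
  ultimately show ?thesis
    by blast
qed

text \<open>
  In a chain for almost containment, finitely many members include a whole member up to a
  finite set; so points can be picked from longer and longer finite intersections.
\<close>

lemma ex_pseudo_intersection:
  fixes F :: "nat set set"
  assumes cnt: "countable F" and inf: "\<And>A. A \<in> F \<Longrightarrow> infinite A"
    and chain: "\<And>A B. A \<in> F \<Longrightarrow> B \<in> F \<Longrightarrow> finite (A - B) \<or> finite (B - A)"
  shows "\<exists>P. infinite P \<and> (\<forall>A\<in>F. finite (P - A))"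
proof (cases "F = {}")
  case True
  then show ?thesis
    using infinite_UNIV_nat by blast
next
  case False
  have least: "G \<noteq> {} \<Longrightarrow> G \<subseteq> F \<Longrightarrow> \<exists>A\<in>G. \<forall>B\<in>G. finite (A - B)" if "finite G" for G
    using that
  proof (induction G)
    case (insert B G)
    show ?case
    proof (cases "G = {}")
      case False
      then obtain A where A: "A \<in> G" "\<forall>C\<in>G. finite (A - C)"
        using insert by auto
      have "finite (A - B) \<or> finite (B - A)"
        using chain insert.prems(2) A(1) by blast
      then show ?thesis
      proof
        assume "finite (A - B)"
        then show ?thesis
          using A by auto
      next
        assume "finite (B - A)"
        then have "\<forall>C\<in>G. finite (B - C)"
          using A(2) finite_Diff_trans by metis
        then show ?thesis by simp
      qed
    qed simp
  qed simp
  obtain D :: "nat \<Rightarrow> nat set" where D: "F = range D"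
    using uncountable_def cnt False by metis
  have inf_INT: "infinite (\<Inter>i\<le>n. D i)" for n
  proof -
    obtain j where j: "j \<le> n" "\<forall>i\<le>n. finite (D j - D i)"
      using least[of "D ` {..n}"] D by auto
    have "infinite (D j)"
      using inf D by blast
    moreover have "D j \<subseteq> (\<Inter>i\<le>n. D i) \<union> (\<Union>i\<le>n. D j - D i)"
      by auto
    ultimately show ?thesis
      using j(2) by (meson atMost_iff finite_UN_I finite_UnI finite_atMost finite_subset)
  qed
  obtain x where x: "strict_mono x" "\<And>n. x n \<in> (\<Inter>i\<le>n. D i)"
    using strict_mono_selection[of "\<lambda>n. \<Inter>i\<le>n. D i", OF inf_INT] by metis
  have "finite (range x - D i)" for i
  proof (rule finite_subset)
    show "range x - D i \<subseteq> x ` {..<i}"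
    proof
      fix y assume "y \<in> range x - D i"
      then obtain n where n: "y = x n" "x n \<notin> D i" by blast
      then have "\<not> i \<le> n"
        using x(2)[of n] by blast
      then show "y \<in> x ` {..<i}"
        using n(1) by simp
    qed
  qed simp
  moreover have "infinite (range x)"
    using x(1) strict_mono_imp_inj_on range_inj_infinite by blast
  ultimately show ?thesis
    unfolding D by blast
qed

text \<open>The set \<open>K\<close> is chosen independently of \<open>b\<close>, so that the two values of \<open>b\<close> give disjoint sets.\<close>

definition half :: "bool \<Rightarrow> nat set \<Rightarrow> nat set" where
  "half b H = (let K = SOME K. K \<subseteq> H \<and> infinite K \<and> infinite (H - K) in if b then K else H - K)"

definition pseudo_intersection :: "nat set set \<Rightarrow> nat set" where
  "pseudo_intersection F = (SOME P. infinite P \<and> (\<forall>A\<in>F. finite (P - A)))"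

definition coloring :: "nat set \<Rightarrow> nat \<Rightarrow> nat \<Rightarrow> bool" where
  "coloring c m n \<longleftrightarrow> prod_encode (m, n) \<in> c"

definition homogeneous_part :: "nat set \<Rightarrow> nat set \<Rightarrow> nat set" where
  "homogeneous_part c P = (SOME H. H \<subseteq> P \<and> infinite H \<and> homogeneous (coloring c) H)"

lemma half_disjoint: "half True H \<inter> half False H = {}"
  by (auto simp: half_def Let_def)

lemma half:
  assumes "infinite H"
  shows "half b H \<subseteq> H" "infinite (half b H)"
  using someI_ex[OF infinite_split[OF assms, unfolded Bex_def]]
  by (auto simp: half_def Let_def)

lemma homogeneous_part:
  assumes "infinite P"
  shows "homogeneous_part c P \<subseteq> P" "infinite (homogeneous_part c P)"
    "homogeneous (coloring c) (homogeneous_part c P)"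
  using someI_ex[OF ex_homogeneous_subset[OF assms, of "coloring c"]]
  by (auto simp: homogeneous_part_def)

lemma pseudo_intersection:
  assumes "\<exists>P. infinite P \<and> (\<forall>A\<in>F. finite (P - A))"
  shows "infinite (pseudo_intersection F)" "A \<in> F \<Longrightarrow> finite (pseudo_intersection F - A)"
  using someI_ex[OF assms] by (auto simp: pseudo_intersection_def)

text \<open>
  The colorings, coded as subsets of \<open>nat\<close>, also index the steps of the recursion. The order is a
  cardinal, so that under CH only countably many steps precede any given one.
\<close>

definition coloring_order :: "nat set rel" where
  "coloring_order = |UNIV|"

text \<open>
  Step \<open>c\<close> of the construction makes the new set homogeneous for \<open>c\<close> and then follows the branch \<open>x\<close>, a
  set of steps, into one of two disjoint halves.
\<close>

definition tower :: "nat set set \<Rightarrow> nat set \<Rightarrow> nat set" where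
  "tower x = wfrec (coloring_order - Id)
     (\<lambda>T c. half (c \<in> x) (homogeneous_part c (pseudo_intersection (T ` underS coloring_order c))))"

lemma Card_order_coloring_order: "Card_order coloring_order"
  unfolding coloring_order_def by (rule card_of_Card_order)

lemma Field_coloring_order: "Field coloring_order = UNIV"
  by (simp add: coloring_order_def Field_card_of)

lemma wf_coloring_order: "wf (coloring_order - Id)"
  using Card_order_coloring_order unfolding card_order_on_def well_order_on_def by blast

lemma coloring_order_cases: "b = c \<or> b \<in> underS coloring_order c \<or> c \<in> underS coloring_order b"
  using Card_order_total[OF Card_order_coloring_order, of b c]
  by (auto simp: underS_def Field_coloring_order)

lemma underS_coloring_order_trans:
  assumes "a \<in> underS coloring_order b" "b \<in> underS coloring_order c"
  shows "a \<in> underS coloring_order c"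
proof -
  have "trans coloring_order" "antisym coloring_order"
    using Card_order_coloring_order
    by (auto simp: card_order_on_def well_order_on_def linear_order_on_def partial_order_on_def preorder_on_def)
  then show ?thesis
    using assms unfolding underS_def by (auto dest: transD antisymD)
qed

lemma underS_coloring_order_induct:
  assumes "\<And>c. (\<And>b. b \<in> underS coloring_order c \<Longrightarrow> \<phi> b) \<Longrightarrow> \<phi> c"
  shows "\<phi> c"
  using wf_coloring_order by (induction c) (rule assms, auto simp: underS_def)

lemma tower_rec:
  "tower x c = half (c \<in> x) (homogeneous_part c (pseudo_intersection (tower x ` underS coloring_order c)))"
proof -
  have "cut (tower x) (coloring_order - Id) c ` underS coloring_order c = tower x ` underS coloring_order c"
    by (rule image_cong) (auto simp: cut_apply underS_def)
  then show ?thesis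
    by (subst def_wfrec[OF tower_def[THEN eq_reflection] wf_coloring_order]) simp
qed

lemma countable_underS_coloring_order:
  assumes CH
  shows "countable (underS coloring_order c)"
proof -
  have "|underS coloring_order c| <o coloring_order"
    by (rule card_of_underS[OF Card_order_coloring_order]) (simp add: Field_coloring_order)
  also have "coloring_order =o continuum"
    unfolding coloring_order_def by (rule ordIso_symmetric[OF continuum_ordIso])
  also have "continuum =o cardSuc natLeq"
    using assms by (simp add: CH_def)
  finally have "|underS coloring_order c| \<le>o natLeq"
    by (simp add: cardSuc_ordLeq_ordLess natLeq_Card_order card_of_Card_order)
  then have "|underS coloring_order c| \<le>o |UNIV :: nat set|"
    using ordIso_symmetric[OF card_of_nat] by (rule ordLeq_ordIso_trans)
  then show ?thesis
    by (auto simp: card_of_ordLeq[symmetric] countable_def)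
qed

lemma tower_decreasing:
  assumes ch: CH
  shows "infinite (tower x c) \<and> homogeneous (coloring c) (tower x c) \<and>
    (\<forall>b\<in>underS coloring_order c. finite (tower x c - tower x b))"
proof (induction c rule: underS_coloring_order_induct)
  case (1 c)
  let ?F = "tower x ` underS coloring_order c"
  have "\<exists>P. infinite P \<and> (\<forall>A\<in>?F. finite (P - A))"
  proof (rule ex_pseudo_intersection)
    show "countable ?F"
      using countable_underS_coloring_order[OF ch] by simp
    show "infinite A" if "A \<in> ?F" for A
      using that 1 by auto
    show "finite (A - B) \<or> finite (B - A)" if AB: "A \<in> ?F" "B \<in> ?F" for A B
    proof -
      obtain a b where ab: "a \<in> underS coloring_order c" "b \<in> underS coloring_order c"
        "A = tower x a" "B = tower x b"
        using AB by blast
      then show ?thesis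
        using coloring_order_cases[of a b] 1[OF ab(1)] 1[OF ab(2)] by auto
    qed
  qed
  note P = pseudo_intersection[OF this]
  let ?H = "homogeneous_part c (pseudo_intersection ?F)"
  note H = homogeneous_part[OF P(1), of c]
  have T: "tower x c \<subseteq> ?H" "infinite (tower x c)"
    unfolding tower_rec[of x c] using half[OF H(2)] by auto
  have "homogeneous (coloring c) (tower x c)"
    using H(3) T(1) by (rule homogeneous_subset)
  moreover have "finite (tower x c - tower x b)" if "b \<in> underS coloring_order c" for b
  proof (rule finite_subset)
    show "tower x c - tower x b \<subseteq> pseudo_intersection ?F - tower x b"
      using H(1) T(1) by blast
    show "finite (pseudo_intersection ?F - tower x b)"
      using that by (intro P(2)) blast
  qed
  ultimately show ?case
    using T(2) by blast
qed

lemma tower_chain: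
  assumes CH
  shows "finite (tower x b - tower x c) \<or> finite (tower x c - tower x b)"
  using coloring_order_cases[of b c] tower_decreasing[OF assms, of x b] tower_decreasing[OF assms, of x c]
  by auto

definition tower_ultrafilter :: "nat set set \<Rightarrow> nat set set" where
  "tower_ultrafilter x = {Z. \<exists>c. finite (tower x c - Z)}"

lemma tower_in: "tower x c \<in> tower_ultrafilter x"
  unfolding tower_ultrafilter_def by (auto intro: exI[of _ c])

lemma ramsey_tower_ultrafilter:
  assumes ch: CH
  shows "ramsey_ultrafilter (tower_ultrafilter x)"
proof -
  let ?U = "tower_ultrafilter x"
  have inf: "infinite A" if "A \<in> ?U" for A
  proof
    assume "finite A"
    obtain c where "finite (tower x c - A)"
      using \<open>A \<in> ?U\<close> unfolding tower_ultrafilter_def by blast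
    then have "finite (tower x c)"
      using \<open>finite A\<close> by simp
    then show False
      using tower_decreasing[OF ch] by blast
  qed
  have mono: "B \<in> ?U" if AB: "A \<in> ?U" "A \<subseteq> B" for A B
  proof -
    obtain c where "finite (tower x c - A)"
      using AB(1) by (auto simp: tower_ultrafilter_def)
    moreover have "tower x c - B \<subseteq> tower x c - A"
      using AB(2) by blast
    ultimately show ?thesis
      unfolding tower_ultrafilter_def using finite_subset by blast
  qed
  have int: "A \<inter> B \<in> ?U" if AB: "A \<in> ?U" "B \<in> ?U" for A B
  proof -
    obtain a b where ab: "finite (tower x a - A)" "finite (tower x b - B)"
      using AB unfolding tower_ultrafilter_def by blast
    consider "finite (tower x a - tower x b)" | "finite (tower x b - tower x a)"
      using tower_chain[OF ch] by blast
    then obtain c where "finite (tower x c - A)" "finite (tower x c - B)"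
      by cases (use ab finite_Diff_trans in metis)+
    then have "finite (tower x c - A \<inter> B)"
      by (simp add: Diff_Int)
    then show ?thesis
      unfolding tower_ultrafilter_def by blast
  qed
  have hom: "\<exists>H\<in>?U. homogeneous R H" for R
  proof -
    have "coloring (Collect (\<lambda>i. case_prod R (prod_decode i))) = R"
      by (simp add: fun_eq_iff coloring_def)
    then have "homogeneous R (tower x (Collect (\<lambda>i. case_prod R (prod_decode i))))"
      using tower_decreasing[OF ch] by metis
    then show ?thesis
      using tower_in by blast
  qed
  have compl: "- A \<in> ?U \<longleftrightarrow> A \<notin> ?U" for A
  proof
    assume "- A \<in> ?U"
    then show "A \<notin> ?U"
      using int[of A "- A"] inf[of "{}"] by auto
  next
    assume A: "A \<notin> ?U"
    obtain H b where H: "H \<in> ?U" "\<And>m n. m \<in> H \<Longrightarrow> n \<in> H \<Longrightarrow> m < n \<Longrightarrow> (m \<in> A) = b"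
      using hom[of "\<lambda>m n. m \<in> A"] unfolding homogeneous_def by meson
    have "(m \<in> A) = b" if "m \<in> H" for m
      using inf[OF H(1)] H(2)[OF that] by (meson infinite_nat_iff_unbounded)
    then have "H \<subseteq> A \<or> H \<subseteq> - A"
      by auto
    then show "- A \<in> ?U"
      using A mono[OF H(1)] by blast
  qed
  have "nat_ultrafilter ?U"
    unfolding nat_ultrafilter_def using int mono compl by (meson Int_lower1 Int_lower2)
  moreover have "{n} \<notin> ?U" for n
    using inf[of "{n}"] by auto
  ultimately show ?thesis
    unfolding ramsey_ultrafilter_def free_ultrafilter_def using hom by blast
qed

text \<open>
  At the first place where two branches differ, the towers continue in disjoint halves of the
  same set.
\<close>

lemma inj_tower_ultrafilter:
  assumes ch: CH
  shows "inj tower_ultrafilter"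
proof (rule injI, rule ccontr)
  fix x y
  assume eq: "tower_ultrafilter x = tower_ultrafilter y" and "x \<noteq> y"
  define Q where "Q = {c. (c \<in> x) \<noteq> (c \<in> y)}"
  have "Q \<noteq> {}"
    using \<open>x \<noteq> y\<close> unfolding Q_def by blast
  then have "\<exists>c\<in>Q. \<forall>b. (b, c) \<in> coloring_order - Id \<longrightarrow> b \<notin> Q"
    using wf_coloring_order unfolding wf_eq_minimal by (metis ex_in_conv)
  then obtain c where c: "(c \<in> x) \<noteq> (c \<in> y)"
    and min: "\<And>b. (b, c) \<in> coloring_order - Id \<Longrightarrow> (b \<in> x) = (b \<in> y)"
    unfolding Q_def by auto
  have same: "b \<in> x \<longleftrightarrow> b \<in> y" if "b \<in> underS coloring_order c" for b
    using min[of b] that by (auto simp: underS_def)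
  have "b \<in> underS coloring_order c \<Longrightarrow> tower x b = tower y b" for b
  proof (induction b rule: underS_coloring_order_induct)
    case (1 b)
    have "tower x ` underS coloring_order b = tower y ` underS coloring_order b"
    proof (rule image_cong)
      fix a assume a: "a \<in> underS coloring_order b"
      show "tower x a = tower y a"
        using a underS_coloring_order_trans[OF a 1(2)] by (rule 1(1))
    qed (rule refl)
    then show ?case
      unfolding tower_rec[of x b] tower_rec[of y b] using same[OF 1(2)] by simp
  qed
  then have im: "tower x ` underS coloring_order c = tower y ` underS coloring_order c"
    by (intro image_cong) auto
  define H where "H = homogeneous_part c (pseudo_intersection (tower x ` underS coloring_order c))"
  have xy: "tower x c = half (c \<in> x) H" "tower y c = half (c \<in> y) H"
    unfolding H_def tower_rec[of x c] tower_rec[of y c] im by simp_all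
  have "tower x c \<inter> tower y c = {}"
    unfolding xy using half_disjoint[of H] c by (cases "c \<in> x") auto
  moreover have "tower x c \<inter> tower y c \<in> tower_ultrafilter x"
    using tower_in[of x c] tower_in[of y c] eq ramsey_tower_ultrafilter[OF ch, of x] nat_ultrafilter_Int
    unfolding ramsey_ultrafilter_def free_ultrafilter_def by metis
  ultimately show False
    using ramsey_tower_ultrafilter[OF ch, of x] nat_ultrafilter_empty
    unfolding ramsey_ultrafilter_def free_ultrafilter_def by metis
qed

section \<open>Doubling a Ramsey ultrafilter\<close>

text \<open>
  The square of an ultrafilter, transported to \<open>nat\<close>. For a Ramsey ultrafilter it has the
  sets of increasing pairs from its members as a base.
\<close>

definition increasing_pairs :: "nat set \<Rightarrow> nat set" where
  "increasing_pairs B = {prod_encode (m, n) | m n. m \<in> B \<and> n \<in> B \<and> m < n}"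

definition pair_ultrafilter :: "nat set set \<Rightarrow> nat set set" where
  "pair_ultrafilter U = {A. \<exists>B\<in>U. increasing_pairs B \<subseteq> A}"

lemma increasing_pairs_iff [simp]:
  "prod_encode (m, n) \<in> increasing_pairs B \<longleftrightarrow> m \<in> B \<and> n \<in> B \<and> m < n"
  by (auto simp: increasing_pairs_def)

lemma increasing_pairs_mono: "B \<subseteq> C \<Longrightarrow> increasing_pairs B \<subseteq> increasing_pairs C"
  by (auto simp: increasing_pairs_def)

text \<open>
  Here lies the difference between the two orders: a point of \<open>B\<close> is the first coordinate of
  infinitely many pairs from \<open>B\<close>, so that it cannot be lost modulo finite sets.
\<close>

lemma increasing_pairs_almost_subset_iff:
  assumes "infinite B"
  shows "finite (increasing_pairs B - increasing_pairs C) \<longleftrightarrow> B \<subseteq> C"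
proof
  assume fin: "finite (increasing_pairs B - increasing_pairs C)"
  show "B \<subseteq> C"
  proof
    fix m assume m: "m \<in> B"
    have "infinite (B - {..m})"
      using assms by simp
    then have "infinite ((\<lambda>n. prod_encode (m, n)) ` (B - {..m}))"
      by (simp add: finite_image_iff inj_on_def)
    then have "\<not> (\<lambda>n. prod_encode (m, n)) ` (B - {..m}) \<subseteq> increasing_pairs B - increasing_pairs C"
      using fin finite_subset by metis
    then obtain n where "n \<in> B - {..m}" "prod_encode (m, n) \<notin> increasing_pairs B - increasing_pairs C"
      by blast
    then show "m \<in> C"
      using m by auto
  qed
next
  assume "B \<subseteq> C"
  then show "finite (increasing_pairs B - increasing_pairs C)"
    using increasing_pairs_mono by (metis Diff_eq_empty_iff finite.emptyI)
qed

lemma free_pair_ultrafilter: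
  assumes U: "ramsey_ultrafilter U"
  shows "free_ultrafilter (pair_ultrafilter U)"
proof -
  have f: "free_ultrafilter U" and u: "nat_ultrafilter U"
    using U by (auto simp: ramsey_ultrafilter_def free_ultrafilter_def)
  let ?W = "pair_ultrafilter U"
  have W: "increasing_pairs B \<in> ?W" if "B \<in> U" for B
    using that unfolding pair_ultrafilter_def by blast
  have inf: "infinite A" if A: "A \<in> ?W" for A
  proof -
    obtain B where B: "B \<in> U" "increasing_pairs B \<subseteq> A"
      using A unfolding pair_ultrafilter_def by blast
    have "infinite B"
      using free_ultrafilter_infinite[OF f B(1)] .
    then have "infinite (increasing_pairs B - increasing_pairs {})"
      using increasing_pairs_almost_subset_iff[of B "{}"] by auto
    then show ?thesis
      using B(2) finite_subset[of "increasing_pairs B - increasing_pairs {}" A] by blast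
  qed
  have mono: "B \<in> ?W" if "A \<in> ?W" "A \<subseteq> B" for A B
    using that unfolding pair_ultrafilter_def by blast
  have int: "A \<inter> A' \<in> ?W" if A: "A \<in> ?W" "A' \<in> ?W" for A A'
  proof -
    obtain B B' where B: "B \<in> U" "increasing_pairs B \<subseteq> A" "B' \<in> U" "increasing_pairs B' \<subseteq> A'"
      using A unfolding pair_ultrafilter_def by blast
    have "B \<inter> B' \<in> U"
      using B(1,3) nat_ultrafilter_Int[OF u] by simp
    moreover have "increasing_pairs (B \<inter> B') \<subseteq> A \<inter> A'"
      using B(2,4) increasing_pairs_mono[of "B \<inter> B'" B] increasing_pairs_mono[of "B \<inter> B'" B'] by blast
    ultimately show ?thesis
      unfolding pair_ultrafilter_def by blast
  qed
  have compl: "- A \<in> ?W \<longleftrightarrow> A \<notin> ?W" for A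
  proof
    assume "- A \<in> ?W"
    then show "A \<notin> ?W"
      using int[of A "- A"] inf[of "{}"] by auto
  next
    assume A: "A \<notin> ?W"
    have "\<exists>H\<in>U. homogeneous (\<lambda>m n. prod_encode (m, n) \<in> A) H"
      using U by (simp add: ramsey_ultrafilter_def)
    then obtain H b where H: "H \<in> U"
      "\<forall>m\<in>H. \<forall>n\<in>H. m < n \<longrightarrow> (prod_encode (m, n) \<in> A) = b"
      unfolding homogeneous_def by meson
    have "increasing_pairs H \<subseteq> A \<or> increasing_pairs H \<subseteq> - A"
      using H(2) by (cases b) (auto simp: increasing_pairs_def)
    then show "- A \<in> ?W"
      using A mono[OF W[OF H(1)]] by blast
  qed
  have "A \<inter> B \<in> ?W \<longleftrightarrow> A \<in> ?W \<and> B \<in> ?W" for A B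
    using int[of A B] mono[of "A \<inter> B" A] mono[of "A \<inter> B" B] by blast
  then have "nat_ultrafilter ?W"
    unfolding nat_ultrafilter_def using compl by blast
  moreover have "{n} \<notin> ?W" for n
    using inf[of "{n}"] by auto
  ultimately show ?thesis
    unfolding free_ultrafilter_def by blast
qed

text \<open>
  In the remainder a Ramsey ultrafilter itself has a neighborhood filter of type \<open>\<omega>\<^sub>1\<close> under CH; to realize
  the type of \<open>(U, \<supseteq>)\<close> there, the point given by the square of \<open>U\<close> is used.
\<close>

lemma ramsey_nbhd_filter_beta_omega_remainder:
  assumes U: "ramsey_ultrafilter U"
  obtains p where "p \<in> topspace beta_omega_remainder"
    "cofinally_equivalent (superset_order U) (nbhd_filter p beta_omega_remainder)"
proof -
  have f: "free_ultrafilter U"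
    using U by (simp add: ramsey_ultrafilter_def)
  have W: "free_ultrafilter (pair_ultrafilter U)"
    using U by (rule free_pair_ultrafilter)
  then obtain p where p: "p \<in> topspace beta_omega" "ultrafilter_of p = pair_ultrafilter U"
    using ultrafilter_of_surj[of "pair_ultrafilter U"] unfolding free_ultrafilter_def by metis
  have pR: "p \<in> topspace beta_omega_remainder"
    using p W by (simp add: topspace_beta_omega_remainder)
  moreover have "cofinally_equivalent (superset_order U) (nbhd_filter p beta_omega_remainder)"
  proof (rule nbhd_filter_beta_omega_remainder_embedding[OF pR Preorder_superset_order, where e = increasing_pairs],
      unfold Field_superset_order p(2))
    show "increasing_pairs B \<in> pair_ultrafilter U" if "B \<in> U" for B
      using that unfolding pair_ultrafilter_def by blast
    show "\<exists>B\<in>U. increasing_pairs B \<subseteq> A" if "A \<in> pair_ultrafilter U" for A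
      using that unfolding pair_ultrafilter_def by blast
    show "(A, B) \<in> superset_order U \<longleftrightarrow> finite (increasing_pairs B - increasing_pairs A)"
      if "A \<in> U" "B \<in> U" for A B
      using that increasing_pairs_almost_subset_iff[OF free_ultrafilter_infinite[OF f that(2)], of A]
      by (simp add: superset_order_def)
  qed
  ultimately show thesis
    by (rule that)
qed

lemma ramsey_nbhd_filter_beta_omega:
  assumes U: "ramsey_ultrafilter U"
  obtains p where "p \<in> topspace beta_omega"
    "cofinally_equivalent (superset_order U) (nbhd_filter p beta_omega)"
proof -
  obtain p where p: "p \<in> topspace beta_omega" "ultrafilter_of p = U"
    using ultrafilter_of_surj[of U] U unfolding ramsey_ultrafilter_def free_ultrafilter_def by metis
  then show thesis
    using nbhd_filter_beta_omega_equivalent[OF p(1)] that[OF p(1)] by simp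
qed

section \<open>Counting cofinal types\<close>

lemma infinite_UNIV_nat_set: "infinite (UNIV :: nat set set)"
  by (rule infinite_super[OF subset_UNIV range_inj_infinite[of "\<lambda>n. {n}"]]) (simp add: inj_def)

lemma ctwo_cexp_continuum: "ctwo ^c continuum =o |UNIV :: nat set set set|"
proof -
  have "ctwo ^c continuum =o ctwo ^c |UNIV :: nat set set|"
    using continuum_ordIso Card_order_ctwo Card_order_continuum by (rule cexp_cong2)
  also have "ctwo ^c |UNIV :: nat set set| =o |Pow (UNIV :: nat set set)|"
    unfolding ctwo_def cexp_def Field_card_of by (rule ordIso_symmetric[OF card_of_Pow_Func])
  finally show ?thesis
    by simp
qed

text \<open>If there were fewer values than arguments, small fibers could not cover the domain.\<close>

lemma card_of_range_small_fibers:
  fixes f :: "'a \<Rightarrow> 'b" and K :: "'c set"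
  assumes K: "infinite K" "|K| <o |UNIV :: 'a set|"
    and fib: "\<And>y. |{x. f x = f y}| \<le>o |K|"
  shows "|UNIV :: 'a set| \<le>o |range f|"
proof (rule ccontr)
  assume "\<not> ?thesis"
  then have less: "|range f| <o |UNIV :: 'a set|"
    using not_ordLeq_iff_ordLess[OF card_of_Well_order card_of_Well_order] by metis
  have U: "(\<Union>z\<in>range f. {x. f x = z}) = UNIV"
    by blast
  have fib': "|{x. f x = z}| \<le>o |K|" if "z \<in> range f" for z
    using that fib by auto
  consider "|range f| \<le>o |K|" | "|K| \<le>o |range f|"
    using ordLeq_total[OF card_of_Well_order card_of_Well_order] by blast
  then show False
  proof cases
    case 1
    have "|\<Union>z\<in>range f. {x. f x = z}| \<le>o |K|"
      using K(1) 1 fib' by (intro card_of_UNION_ordLeq_infinite) auto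
    then show False
      unfolding U using K(2) not_ordLess_ordLeq by blast
  next
    case 2
    have "infinite (range f)"
      using K(1) 2 card_of_ordLeq_infinite by blast
    moreover have "|{x. f x = z}| \<le>o |range f|" if "z \<in> range f" for z
      using fib'[OF that] 2 by (rule ordLeq_transitive)
    ultimately have "|\<Union>z\<in>range f. {x. f x = z}| \<le>o |range f|"
      using card_of_mono1[OF subset_refl] by (intro card_of_UNION_ordLeq_infinite ballI)
    then show False
      unfolding U using less not_ordLess_ordLeq by blast
  qed
qed

lemma few_equivalent_tower_ultrafilters:
  assumes ch: CH
  shows "|{x. cofinally_equivalent (superset_order (tower_ultrafilter x)) (superset_order (tower_ultrafilter y))}|
    \<le>o |UNIV :: nat set set|"
proof -
  let ?E = "{x. cofinally_equivalent (superset_order (tower_ultrafilter x)) (superset_order (tower_ultrafilter y))}"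
  have "tower_ultrafilter ` ?E \<subseteq> range (decoded_filter (tower_ultrafilter y))"
  proof (rule image_subsetI)
    fix x assume "x \<in> ?E"
    then have eq: "cofinally_equivalent (superset_order (tower_ultrafilter x)) (superset_order (tower_ultrafilter y))"
      by simp
    have "nat_ultrafilter (tower_ultrafilter x)"
      using ramsey_tower_ultrafilter[OF ch, of x] by (simp add: ramsey_ultrafilter_def free_ultrafilter_def)
    then show "tower_ultrafilter x \<in> range (decoded_filter (tower_ultrafilter y))"
      using eq by (rule ultrafilter_below_ramsey_decoded[OF ramsey_tower_ultrafilter[OF ch]])
  qed
  moreover have "inj_on tower_ultrafilter ?E"
    using inj_tower_ultrafilter[OF ch] by (rule inj_on_subset) simp
  ultimately have "|?E| \<le>o |range (decoded_filter (tower_ultrafilter y))|"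
    unfolding card_of_ordLeq[symmetric] by blast
  also have "|range (decoded_filter (tower_ultrafilter y))| \<le>o |UNIV :: (nat set \<times> nat set) set|"
    by (rule card_of_image)
  also have "|UNIV :: (nat set \<times> nat set) set| =o |UNIV :: nat set set|"
    using card_of_Times_same_infinite[OF infinite_UNIV_nat_set] by simp
  finally show ?thesis .
qed

text \<open>
  There are two to the continuum Ramsey ultrafilters, and each has at most continuum many of them in its
  cofinal type.
\<close>

lemma many_cofinal_types:
  fixes X :: "((nat \<Rightarrow> real) \<Rightarrow> real) topology"
  assumes ch: CH and sub: "topspace X \<subseteq> topspace beta_omega"
    and ex: "\<And>U. ramsey_ultrafilter U \<Longrightarrow>
      \<exists>p\<in>topspace X. cofinally_equivalent (superset_order U) (nbhd_filter p X)"
  shows "|cofinal_type ` nbhd_filters X| =o ctwo ^c continuum"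
proof -
  let ?T = "cofinal_type ` nbhd_filters X"
  have "|?T| \<le>o |nbhd_filters X|"
    by (rule card_of_image)
  also have "|nbhd_filters X| \<le>o |topspace X|"
    unfolding nbhd_filters_def by (rule card_of_image)
  also have "|topspace X| \<le>o |UNIV :: nat set set set|"
    using inj_on_subset[OF inj_on_ultrafilter_of sub] unfolding card_of_ordLeq[symmetric] by blast
  finally have le: "|?T| \<le>o |UNIV :: nat set set set|" .
  have "\<forall>x. \<exists>p\<in>topspace X.
      cofinally_equivalent (superset_order (tower_ultrafilter x)) (nbhd_filter p X)"
    using ex ramsey_tower_ultrafilter[OF ch] by blast
  then obtain p where p: "\<And>x. p x \<in> topspace X"
    and eq: "\<And>x. cofinally_equivalent (superset_order (tower_ultrafilter x)) (nbhd_filter (p x) X)"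
    by metis
  define f where "f x = cofinal_type (nbhd_filter (p x) X)" for x
  have fib: "|{x. f x = f y}| \<le>o |UNIV :: nat set set|" for y
  proof -
    have "cofinally_equivalent (superset_order (tower_ultrafilter x)) (superset_order (tower_ultrafilter y))"
      if "f x = f y" for x
    proof -
      have "cofinally_equivalent (nbhd_filter (p x) X) (nbhd_filter (p y) X)"
        using that by (simp add: f_def cofinal_type_eq_iff Preorder_nbhd_filter)
      from cofinally_equivalent_trans[OF cofinally_equivalent_trans[OF eq this] cofinally_equivalent_sym[OF eq]]
      show ?thesis .
    qed
    then have "|{x. f x = f y}| \<le>o |{x. cofinally_equivalent
        (superset_order (tower_ultrafilter x)) (superset_order (tower_ultrafilter y))}|"
      by (intro card_of_mono1) blast
    then show ?thesis
      using few_equivalent_tower_ultrafilters[OF ch] by (rule ordLeq_transitive)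
  qed
  have "|UNIV :: nat set set| <o |UNIV :: nat set set set|"
    using card_of_Pow[of "UNIV :: nat set set"] by simp
  then have "|UNIV :: nat set set set| \<le>o |range f|"
    using fib by (intro card_of_range_small_fibers[OF infinite_UNIV_nat_set])
  also have "|range f| \<le>o |?T|"
    using p by (intro card_of_mono1) (auto simp: f_def nbhd_filters_def)
  finally have "|?T| =o |UNIV :: nat set set set|"
    using le by (simp add: ordIso_iff_ordLeq)
  then show ?thesis
    using ordIso_symmetric[OF ctwo_cexp_continuum] by (rule ordIso_transitive)
qed

text \<open>
  The two spaces differ only in the point that realizes the type of a Ramsey ultrafilter, and in the
  order, by containment or by almost containment, that describes a neighborhood filter.
\<close>

theorem theorem4p10:
  assumes CH
  shows "(\<forall>X \<in> {beta_omega_remainder, beta_omega}.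
            |cofinal_type ` nbhd_filters X| =o ctwo ^c continuum) \<and>
         (\<forall>P \<in> nbhd_filters beta_omega_remainder.
            cofinally_scalene P \<longrightarrow> cofinally_equivalent P continuum) \<and>
         (\<forall>P \<in> nbhd_filters beta_omega.
            cofinally_scalene P \<longrightarrow> cofinally_equivalent P BNF_Cardinal_Arithmetic.cone)"
proof (intro conjI)
  have "|cofinal_type ` nbhd_filters beta_omega_remainder| =o ctwo ^c continuum"
  proof (rule many_cofinal_types[OF assms])
    show "topspace beta_omega_remainder \<subseteq> topspace beta_omega"
      by (auto simp: topspace_beta_omega_remainder)
    show "\<exists>p\<in>topspace beta_omega_remainder.
        cofinally_equivalent (superset_order U) (nbhd_filter p beta_omega_remainder)"
      if U: "ramsey_ultrafilter U" for U
      by (rule ramsey_nbhd_filter_beta_omega_remainder[OF U]) blast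
  qed
  moreover have "|cofinal_type ` nbhd_filters beta_omega| =o ctwo ^c continuum"
  proof (rule many_cofinal_types[OF assms subset_refl])
    show "\<exists>p\<in>topspace beta_omega. cofinally_equivalent (superset_order U) (nbhd_filter p beta_omega)"
      if U: "ramsey_ultrafilter U" for U
      by (rule ramsey_nbhd_filter_beta_omega[OF U]) blast
  qed
  ultimately show "\<forall>X \<in> {beta_omega_remainder, beta_omega}.
      |cofinal_type ` nbhd_filters X| =o ctwo ^c continuum"
    by simp
  show "\<forall>P \<in> nbhd_filters beta_omega_remainder.
      cofinally_scalene P \<longrightarrow> cofinally_equivalent P continuum"
    using cofinally_scalene_nbhd_filter_beta_omega_remainder[OF assms]
    by (auto simp: nbhd_filters_def)
  show "\<forall>P \<in> nbhd_filters beta_omega.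
      cofinally_scalene P \<longrightarrow> cofinally_equivalent P BNF_Cardinal_Arithmetic.cone"
    using cofinally_scalene_nbhd_filter_beta_omega by (auto simp: nbhd_filters_def)
qed

end
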